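(* Suppose that $(X_n)_{n\ge0}$ is a stationary sequence of random variables and that $(\kappa(X_i))_{i\ge0}$ is a sequence of i.i.d. random variables with finite first moment; let $\kappa_1=\mathbb E(\kappa(X_1))$. Suppose moreover that $(\kappa(X_i))_{i\ge0}$ is independent of $(\xi(X_i))_{i\ge0}$, that $\nu$ satisfies $$\forall x\in\mathbb X,\quad\nu=\inf\Big\{\gamma>0:\ \sum_{n\ge0}\kappa_1^n\,\mathbb E\big[e^{-\gamma S_{n+1}}\,\big|\,X_0=x\big]<\infty\Big\}<\infty,$$ and that the analyticity assumption stated in the context is satisfied for some positive $\delta$ strictly less than $\nu$ (with the associated $\tilde C_0$, $\Psi_0$). If $\mathbb E(e^{-\nu\xi(X_0)}\tilde C_0(X_0))<\infty$ and $\mathbb E(e^{-(\nu-\delta)\xi(X_0)}\Psi_0(X_0))<\infty$, then $\mathbb E(N_t)<\infty$ and there exists $\epsilon_1>0$ such that $$\mathbb E(N_t)=e^{\nu t}\,\kappa_1\,\mathbb E\big(e^{-\nu\xi(X_0)}\tilde C_0(X_0)\big)\,\big[1+O(e^{-\epsilon_1t})\big]\quad\text{as }t\to\infty.$$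
   Context: Branching model. $(\mathbb X,\mathcal X)$ is a measurable space, $\xi:\mathbb X\to[0,+\infty)$ and $\kappa:\mathbb X\to\{2,3,\dots\}$ are measurable functions, and $(X_n)_{n\ge 0}$ is an $\mathbb X$-valued process. Cells are labelled by finite sequences $v=(k_1,\dots,k_n)$ of positive integers ($n$ is the generation of $v$; the empty sequence labels the single initial cell, born at time $0$). To each label $v$ is attached an $\mathbb X$-valued random variable $X_v$ in such a way that, along every infinite line of descent $(v_n)_{n\ge0}$ ($v_0=\emptyset$ and $v_{n+1}$ is obtained from $v_n$ by appending one positive integer), the process $(X_{v_n})_{n\ge 0}$ has the same law as $(X_n)_{n\ge 0}$. A cell $v$ has lifetime $\xi(X_v)$ and at the end of its lifetime it splits into $\kappa(X_v)$ new cells, labelled by appending $1,\dots,\kappa(X_v)$ to $v$. $N_t$ is the number of cells alive at time $t$ (a cell being alive from its birth time, included, to its death time, excluded). $S_n:=\sum_{j=0}^n\xi(X_j)$ and $\nu:=\inf\big\{\gamma>0:\ \sum_{n\ge0}\mathbb E\big[(\prod_{j=0}^{n-1}\kappa(X_j))(\kappa(X_n)-1)e^{-\gamma S_n}\big]<\infty\big\}$. Analyticity assumption. Let $f_{x,0}(t)=(\kappa_1-1)e^{-\nu t}\sum_{n\ge0}\kappa_1^n\,\mathbb P(S_{n+1}-S_0\le t\,|\,X_0=x)$ and, for $\gamma>0$, $\tilde f_{x,0}(\gamma)=\int_0^\infty e^{-\gamma t}f_{x,0}(t)\,dt=\frac{\kappa_1-1}{\gamma+\nu}\sum_{n\ge0}\kappa_1^n\,\mathbb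 E[e^{-(\gamma+\nu)(S_{n+1}-S_0)}|X_0=x]$. There exist positive reals $\delta<\nu$ and $\epsilon$ such that, for every $x\in\mathbb X$, the Laplace transform $\tilde f_{x,0}$, extended on the complex plane, satisfies: (1) it is analytic in $\{z=u+iy:|u|<\delta+\epsilon,\ y\in\mathbb R\}\setminus\{0\}$; (2) it has a simple pole at $0$, with residue denoted $\tilde C_0(x)$; (3) $\int_{-\infty}^{+\infty}|\tilde f_{x,0}(\delta+iy)|\,dy<\infty$; (4) $\lim_{y\to\pm\infty}\tilde f_{x,0}(u+iy)=0$ uniformly in $u\in[-\delta,\delta]$; (5) $\Psi_0(x):=\int_{-\infty}^{+\infty}|\tilde f_{x,0}(-\delta+iy)|\,dy<\infty$. *)

theory Defs
  imports "HOL-Probability.Probability" "HOL-Complex_Analysis.Complex_Analysis"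
begin

text \<open>
  Cells are labelled by lists of positive naturals. The ancestors of \<open>v\<close> are the proper
  prefixes \<open>take i v\<close>, \<open>i < length v\<close>; a line of descent is given by the sequence \<open>k\<close> of the
  integers that are successively appended.
\<close>

definition descent :: "(nat \<Rightarrow> nat) \<Rightarrow> nat \<Rightarrow> nat list" where
  "descent k n = map k [0..<n]"

locale branching_model = prob_space M
  for M :: "'w measure" +
  fixes MX :: "'x measure"
    and \<xi> :: "'x \<Rightarrow> real"
    and \<kappa> :: "'x \<Rightarrow> nat"
    and X :: "nat \<Rightarrow> 'w \<Rightarrow> 'x"
    and Xc :: "nat list \<Rightarrow> 'w \<Rightarrow> 'x"
  assumes measurable_lifetime: "\<xi> \<in> borel_measurable MX"
    and lifetime_nonneg: "\<And>x. x \<in> space MX \<Longrightarrow> 0 \<le> \<xi> x"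
    and measurable_offspring: "\<kappa> \<in> MX \<rightarrow>\<^sub>M count_space UNIV"
    and offspring_ge_2: "\<And>x. x \<in> space MX \<Longrightarrow> 2 \<le> \<kappa> x"
    and measurable_X: "\<And>n. X n \<in> M \<rightarrow>\<^sub>M MX"
    and measurable_Xc: "\<And>v. (\<forall>k\<in>set v. 1 \<le> k) \<Longrightarrow> Xc v \<in> M \<rightarrow>\<^sub>M MX"
    and descent_law: "\<And>k. (\<And>n. 1 \<le> k n) \<Longrightarrow>
          distr M (\<Pi>\<^sub>M n\<in>UNIV. MX) (\<lambda>\<omega> n. Xc (descent k n) \<omega>)
            = distr M (\<Pi>\<^sub>M n\<in>UNIV. MX) (\<lambda>\<omega> n. X n \<omega>)"
begin

definition cell_exists :: "'w \<Rightarrow> nat list \<Rightarrow> bool" where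
  "cell_exists \<omega> v \<longleftrightarrow> (\<forall>i<length v. v ! i \<in> {1..\<kappa> (Xc (take i v) \<omega>)})"

definition birth_time :: "'w \<Rightarrow> nat list \<Rightarrow> real" where
  "birth_time \<omega> v = (\<Sum>i<length v. \<xi> (Xc (take i v) \<omega>))"

definition death_time :: "'w \<Rightarrow> nat list \<Rightarrow> real" where
  "death_time \<omega> v = birth_time \<omega> v + \<xi> (Xc v \<omega>)"

text \<open>The number of cells alive is a priori possibly infinite, hence counted in \<open>[0,\<infinity>]\<close>.\<close>

definition N :: "real \<Rightarrow> 'w \<Rightarrow> ennreal" where
  "N t \<omega> = emeasure (count_space UNIV)
     {v. cell_exists \<omega> v \<and> birth_time \<omega> v \<le> t \<and> t < death_time \<omega> v}"

definition S :: "nat \<Rightarrow> 'w \<Rightarrow> real" where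
  "S n \<omega> = (\<Sum>j\<le>n. \<xi> (X j \<omega>))"

text \<open>The infimum is taken in the extended reals, so that it is \<open>\<infinity>\<close> for the empty set.\<close>

definition malthus :: ereal where
  "malthus = Inf {ereal \<gamma> | \<gamma>. 0 < \<gamma> \<and>
     (\<Sum>n. \<integral>\<^sup>+\<omega>. ennreal ((\<Prod>j<n. real (\<kappa> (X j \<omega>))) * (real (\<kappa> (X n \<omega>)) - 1)
                        * exp (- \<gamma> * S n \<omega>)) \<partial>M) < \<infinity>}"

definition stationary_X :: bool where
  "stationary_X \<longleftrightarrow> (\<forall>m. distr M (\<Pi>\<^sub>M n\<in>UNIV. MX) (\<lambda>\<omega> n. X (m + n) \<omega>)
                        = distr M (\<Pi>\<^sub>M n\<in>UNIV. MX) (\<lambda>\<omega> n. X n \<omega>))"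

definition \<kappa>\<^sub>1 :: real where
  "\<kappa>\<^sub>1 = expectation (\<lambda>\<omega>. real (\<kappa> (X 1 \<omega>)))"

end

definition lifetime_space :: "(nat \<Rightarrow> real) measure" where
  "lifetime_space = (\<Pi>\<^sub>M n\<in>UNIV. restrict_space borel {0..})"

text \<open>
  \<open>K\<close> is a regular conditional distribution of \<open>Y\<close> given \<open>Z\<close>: \<open>K z\<close> is the law of \<open>Y\<close> given
  \<open>Z = z\<close>.
\<close>

definition regular_cond_distr ::
    "'w measure \<Rightarrow> 'z measure \<Rightarrow> ('w \<Rightarrow> 'z) \<Rightarrow> 'y measure \<Rightarrow> ('w \<Rightarrow> 'y) \<Rightarrow> ('z \<Rightarrow> 'y measure) \<Rightarrow> bool" where
  "regular_cond_distr M MZ Z MY Y K \<longleftrightarrow>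
     K \<in> MZ \<rightarrow>\<^sub>M prob_algebra MY \<and>
     (\<forall>A\<in>sets MZ. \<forall>B\<in>sets MY.
        emeasure M {\<omega>\<in>space M. Z \<omega> \<in> A \<and> Y \<omega> \<in> B}
          = (\<integral>\<^sup>+z\<in>A. emeasure (K z) B \<partial>distr M MZ Z))"

text \<open>
  Below, \<open>k1\<close> is the mean offspring number and \<open>P\<close> is a law on sequences \<open>s\<close> of
  lifetimes, to be used with the conditional law of \<open>(\<xi> (X n))\<^sub>n\<close> given \<open>X 0 = x\<close>. Thus
  \<open>\<Sum>j\<le>n + 1. s j\<close> stands for \<open>S\<^bsub>n+1\<^esub>\<close> and \<open>\<Sum>j=1..n + 1. s j\<close> for \<open>S\<^bsub>n+1\<^esub> - S\<^bsub>0\<^esub>\<close>.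
\<close>

definition cond_malthus :: "real \<Rightarrow> (nat \<Rightarrow> real) measure \<Rightarrow> ereal" where
  "cond_malthus k1 P = Inf {ereal \<gamma> | \<gamma>. 0 < \<gamma> \<and>
     (\<Sum>n. ennreal (k1 ^ n) * (\<integral>\<^sup>+s. ennreal (exp (- \<gamma> * (\<Sum>j\<le>n + 1. s j))) \<partial>P)) < \<infinity>}"

definition f0 :: "real \<Rightarrow> real \<Rightarrow> (nat \<Rightarrow> real) measure \<Rightarrow> real \<Rightarrow> ennreal" where
  "f0 k1 \<nu> P t = ennreal ((k1 - 1) * exp (- \<nu> * t)) *
     (\<Sum>n. ennreal (k1 ^ n) * emeasure P {s \<in> space P. (\<Sum>j=1..n + 1. s j) \<le> t})"

definition laplace :: "(real \<Rightarrow> ennreal) \<Rightarrow> real \<Rightarrow> ennreal" where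
  "laplace f \<gamma> = (\<integral>\<^sup>+t\<in>{0..}. ennreal (exp (- \<gamma> * t)) * f t \<partial>lborel)"

text \<open>
  \<open>F\<close> extends the real transform \<open>L\<close> to the complex plane; its values off the positive real
  axis matter only in the strip \<open>\<bar>Re z\<bar> < \<delta> + \<epsilon>\<close>, where they are determined by \<open>L\<close>. The
  residue at \<open>0\<close> is the real number \<open>c\<close>.
\<close>

definition analytic_extension ::
    "(real \<Rightarrow> ennreal) \<Rightarrow> real \<Rightarrow> real \<Rightarrow> (complex \<Rightarrow> complex) \<Rightarrow> real \<Rightarrow> bool" where
  "analytic_extension L \<delta> \<epsilon> F c \<longleftrightarrow>
     (\<forall>\<gamma>>0. L \<gamma> < \<infinity> \<and> F (complex_of_real \<gamma>) = complex_of_real (enn2real (L \<gamma>))) \<and>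
     F analytic_on ({z. \<bar>Re z\<bar> < \<delta> + \<epsilon>} - {0}) \<and>
     is_pole F 0 \<and> zorder F 0 = -1 \<and> residue F 0 = complex_of_real c \<and>
     integrable lborel (\<lambda>y. norm (F (Complex \<delta> y))) \<and>
     uniform_limit {-\<delta>..\<delta>} (\<lambda>y u. F (Complex u y)) (\<lambda>u. 0) at_top \<and>
     uniform_limit {-\<delta>..\<delta>} (\<lambda>y u. F (Complex u y)) (\<lambda>u. 0) at_bot \<and>
     integrable lborel (\<lambda>y. norm (F (Complex (- \<delta>) y)))"

definition \<Psi>\<^sub>0 :: "real \<Rightarrow> (complex \<Rightarrow> complex) \<Rightarrow> real" where
  "\<Psi>\<^sub>0 \<delta> F = (LINT y|lborel. norm (F (Complex (- \<delta>) y)))"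

end

(* Counting the cells of each generation along lines of descent, and using that the offspring numbers
   are i.i.d. and independent of the lifetimes, gives
     E N_t = sum_n k^n P(S_{n-1} <= t < S_n)
           = 1 + (k - 1) P(S_0 <= t) + k E[exp(nu (t - xi(X_0))) f_{X_0,0}(t - xi(X_0))],
   with k the mean offspring number. No restriction to xi(X_0) <= t is needed, because f_{x,0} vanishes
   on the negative axis. It remains to show |f_{x,0}(s) - C_0(x)| <= exp(-delta s) Psi_0(x) for ALL real s.
   For this, exp(-delta s) f_{x,0}(s) is normalised to a probability density; its characteristic
   function is the Laplace transform on the line Re z = delta, so Levy's inversion theorem applies, and
   monotonicity of exp(nu s) f_{x,0}(s) turns the inversion formula for measures of short intervals into
   a pointwise one. Moving the contour to Re z = -delta collects the residue C_0(x), which is positive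
   as the nonzero limit of z F(z) when z decreases to 0. *)

theory Submission
  imports Defs
begin

text \<open>The inversion formula is needed at every point, not merely almost everywhere: it is
  evaluated at \<open>t - \<xi> (X 0 \<omega>)\<close>, whose law is arbitrary and may have atoms.
  Continuity of f_{x,0} is not among the hypotheses, so the value at s is caught between one-sided
  averages: up to exponential factors tending to 1, averages to the right of s bound it from above
  and averages to the left from below, and both have the same limit. The model leaves the dependence
  between different lines of descent open. Expectation is linear over labels and sees each label
  only through its own line, so the mean is that of a tree in which all cells of generation n share
  the type X_n. The absolute error has two sources: the bounded term 1 + (k - 1) P(S_0 \<le> t) and
  the transform on Re z = -delta. Relative to exp(nu t) the former is of order exp(-nu t), which
  delta < nu absorbs, so delta itself serves as the rate. Positivity of the leading constant is what
  allows the error to be stated as a relative one.\<close>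

section \<open>Fourier inversion\<close>

text \<open>With w = -it(b - a) the quotient equals iexp(-ta) (exp w - 1)/w, and (exp w - 1)/w tends
  to the derivative of exp at 0.\<close>

lemma iexp_quotient_tendsto:
  fixes a b :: "nat \<Rightarrow> real"
  assumes ab: "\<And>n. a n < b n" "a \<longlonglongrightarrow> s" "b \<longlonglongrightarrow> s" and t: "t \<noteq> 0"
  shows "(\<lambda>n. (iexp (-(t * a n)) - iexp (-(t * b n))) / (\<i> * t) / (b n - a n)) \<longlonglongrightarrow> iexp (-(t * s))"
proof -
  define w where "w n = - (\<i> * complex_of_real t * complex_of_real (b n - a n))" for n
  have w0: "w n \<noteq> 0" for n
    using ab(1)[of n] t by (simp add: w_def flip: of_real_diff)
  have "(\<lambda>n. b n - a n) \<longlonglongrightarrow> s - s"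
    by (intro tendsto_intros ab)
  then have "(\<lambda>n. complex_of_real (b n - a n)) \<longlonglongrightarrow> 0"
    using tendsto_of_real by fastforce
  then have "(\<lambda>n. - (\<i> * complex_of_real t * complex_of_real (b n - a n))) \<longlonglongrightarrow> - (\<i> * complex_of_real t * 0)"
    by (intro tendsto_intros)
  then have "w \<longlonglongrightarrow> 0"
    by (simp add: w_def[abs_def])
  then have wat: "filterlim w (at 0) sequentially"
    using w0 by (simp add: filterlim_at)
  have "((\<lambda>x::complex. (exp (0 + x) - exp 0) / x) \<longlongrightarrow> exp 0) (at 0)"
    using DERIV_exp[of "0::complex"] unfolding DERIV_def by simp
  then have "(\<lambda>n. (exp (0 + w n) - exp 0) / w n) \<longlonglongrightarrow> exp 0"
    by (rule filterlim_compose[OF _ wat])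
  then have "(\<lambda>n. iexp (-(t * a n)) * ((exp (0 + w n) - exp 0) / w n)) \<longlonglongrightarrow> iexp (-(t * s)) * exp 0"
    by (intro tendsto_intros ab)
  moreover have "iexp (-(t * a n)) * ((exp (0 + w n) - exp 0) / w n)
      = (iexp (-(t * a n)) - iexp (-(t * b n))) / (\<i> * t) / (b n - a n)" for n
  proof -
    have "iexp (-(t * a n)) * exp (w n) = iexp (-(t * b n))"
      unfolding w_def exp_add[symmetric] by (rule arg_cong[where f=exp]) (simp add: algebra_simps)
    then show ?thesis
      using w0[of n] t ab(1)[of n] by (simp add: w_def field_simps)
  qed
  ultimately show ?thesis by simp
qed

text \<open>Levy's theorem gives only a limit of integrals over (-n, n). The kernel is bounded by b
  - a, so an integrable characteristic function dominates the integrands and the truncation can be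
  removed.\<close>

lemma (in real_distribution) measure_Ioc_eq_char_integral:
  assumes int: "integrable lborel (char M)"
    and at: "measure M {a} = 0" "measure M {b} = 0" and ab: "a \<le> b"
  shows "complex_of_real (measure M {a<..b}) = 1 / (2 * pi) *
      (CLINT t|lborel. (iexp (-(t * a)) - iexp (-(t * b))) / (\<i> * t) * char M t)"
proof (rule LIMSEQ_unique[OF Levy_Inversion[OF ab at]])
  let ?F = "\<lambda>t::real. (iexp (-(t * a)) - iexp (-(t * b))) / (\<i> * t) * char M t"
  have bound: "norm (?F t) \<le> (b - a) * norm (char M t)" if "t \<noteq> 0" for t
    using Levy_Inversion_aux2[of "-b" "-a" t] ab that
    unfolding norm_mult[of _ "char M t"] by (intro mult_right_mono) simp_all
  have "(\<lambda>n::nat. CLINT t|lborel. indicator {-real n<..<real n} t *\<^sub>R ?F t) \<longlonglongrightarrow> (CLINT t|lborel. ?F t)"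
  proof (rule integral_dominated_convergence[where w="\<lambda>t. (b - a) * norm (char M t)"])
    show "integrable lborel (\<lambda>t. (b - a) * norm (char M t))"
      using int by auto
    have [measurable]: "char M \<in> borel_measurable lborel"
      using int by (rule borel_measurable_integrable)
    show "?F \<in> borel_measurable lborel" by measurable
    show "(\<lambda>t. indicator {-real n<..<real n} t *\<^sub>R ?F t) \<in> borel_measurable lborel" for n
      by measurable
    show "AE t in lborel. (\<lambda>n. indicator {-real n<..<real n} t *\<^sub>R ?F t) \<longlonglongrightarrow> ?F t"
    proof (rule AE_I2)
      fix t :: real
      obtain m :: nat where "\<bar>t\<bar> < real m" using reals_Archimedean2 by blast
      then have "\<forall>\<^sub>F n in sequentially. indicator {-real n<..<real n} t *\<^sub>R ?F t = ?F t"
        by (intro eventually_sequentiallyI[of m]) (auto simp: indicator_def)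
      then show "(\<lambda>n. indicator {-real n<..<real n} t *\<^sub>R ?F t) \<longlonglongrightarrow> ?F t"
        by (rule tendsto_eventually)
    qed
    show "AE t in lborel. norm (indicator {-real n<..<real n} t *\<^sub>R ?F t) \<le> (b - a) * norm (char M t)" for n
      using AE_lborel_singleton[of "0::real"]
    proof eventually_elim
      case (elim t)
      have "norm (indicator {-real n<..<real n} t *\<^sub>R ?F t) \<le> norm (?F t)"
        by (simp add: indicator_def)
      then show ?case using bound[OF elim] by linarith
    qed
  qed
  then have "(\<lambda>n::nat. 1 / (2 * pi) * (CLINT t|lborel. indicator {-real n<..<real n} t *\<^sub>R ?F t))
      \<longlonglongrightarrow> 1 / (2 * pi) * (CLINT t|lborel. ?F t)"
    by (intro tendsto_intros)
  then show "(\<lambda>n::nat. 1 / (2 * pi) * (CLBINT t=-n..n. ?F t)) \<longlonglongrightarrow> 1 / (2 * pi) * (CLINT t|lborel. ?F t)"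
    by (simp add: interval_lebesgue_integral_def set_lebesgue_integral_def)
qed

text \<open>Divided by b - a, the Levy kernel is bounded by 1, so the dominating function does not
  depend on the interval. The intervals may lie on either side of s; that the limit is the same on
  both sides is what \<open>laplace_inversion\<close> exploits.\<close>

lemma (in real_distribution) measure_Ioc_quotient_tendsto:
  fixes a b :: "nat \<Rightarrow> real"
  assumes int: "integrable lborel (char M)" and at: "\<And>x. measure M {x} = 0"
    and ab: "\<And>n. a n < b n" "a \<longlonglongrightarrow> s" "b \<longlonglongrightarrow> s"
  shows "(\<lambda>n. complex_of_real (measure M {a n<..b n} / (b n - a n)))
    \<longlonglongrightarrow> 1 / (2 * pi) * (CLINT t|lborel. iexp (-(t * s)) * char M t)"
proof -
  let ?F = "\<lambda>n t::real. (iexp (-(t * a n)) - iexp (-(t * b n))) / (\<i> * t) / (b n - a n) * char M t"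
  have "complex_of_real (measure M {a n<..b n} / (b n - a n)) = 1 / (2 * pi) * (CLINT t|lborel. ?F n t)" for n
  proof -
    have "(CLINT t|lborel. ?F n t) =
      (CLINT t|lborel. ((iexp (-(t * a n)) - iexp (-(t * b n))) / (\<i> * t) * char M t) / (b n - a n))"
      by (intro Bochner_Integration.integral_cong) (auto simp: field_simps)
    also have "\<dots> = (CLINT t|lborel. (iexp (-(t * a n)) - iexp (-(t * b n))) / (\<i> * t) * char M t) / (b n - a n)"
      by (rule integral_divide_zero)
    finally show ?thesis
      using measure_Ioc_eq_char_integral[OF int at at, of "a n" "b n"] ab(1)[of n] by simp
  qed
  moreover have "(\<lambda>n. CLINT t|lborel. ?F n t) \<longlonglongrightarrow> (CLINT t|lborel. iexp (-(t * s)) * char M t)"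
  proof (rule integral_dominated_convergence[where w="\<lambda>t. norm (char M t)"])
    show "integrable lborel (\<lambda>t. norm (char M t))"
      using int by auto
    have [measurable]: "char M \<in> borel_measurable lborel"
      using int by (rule borel_measurable_integrable)
    show "?F n \<in> borel_measurable lborel" for n by measurable
    show "(\<lambda>t. iexp (-(t * s)) * char M t) \<in> borel_measurable lborel"
      by measurable
    show "AE t in lborel. (\<lambda>n. ?F n t) \<longlonglongrightarrow> iexp (-(t * s)) * char M t"
      using AE_lborel_singleton[of "0::real"]
      by eventually_elim (intro tendsto_intros iexp_quotient_tendsto ab)
    show "AE t in lborel. norm (?F n t) \<le> norm (char M t)" for n
      using AE_lborel_singleton[of "0::real"]
    proof eventually_elim
      case (elim t)
      have "norm ((iexp (-(t * a n)) - iexp (-(t * b n))) / (\<i> * t)) \<le> b n - a n"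
        using Levy_Inversion_aux2[of "- b n" "- a n" t] ab(1)[of n] elim by simp
      then have "norm ((iexp (-(t * a n)) - iexp (-(t * b n))) / (\<i> * t) / (b n - a n)) \<le> 1"
        using ab(1)[of n] by (subst norm_divide) (simp flip: of_real_diff)
      then show ?case
        unfolding norm_mult[of _ "char M t"] by (rule mult_left_le_one_le[rotated 2]) auto
    qed
  qed
  ultimately show ?thesis
    by (simp only:) (intro tendsto_intros)
qed

section \<open>Holomorphy of Laplace transforms on the right half-plane\<close>

lemma laplace_transform_holomorphic:
  fixes f :: "real \<Rightarrow> real"
  assumes int: "\<And>\<gamma>. 0 < \<gamma> \<Longrightarrow> integrable lborel (\<lambda>t. exp (- \<gamma> * t) * f t)"
    and neg: "\<And>t. t < 0 \<Longrightarrow> f t = 0"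
  shows "(\<lambda>z. CLINT t|lborel. exp (- z * of_real t) * of_real (f t)) holomorphic_on {z. 0 < Re z}"
proof -
  let ?G = "\<lambda>z. CLINT t|lborel. exp (- z * of_real t) * of_real (f t)"
  have [measurable]: "f \<in> borel_measurable borel"
  proof -
    have "(\<lambda>t. exp t * (exp (- 1 * t) * f t)) \<in> borel_measurable lborel"
      using borel_measurable_integrable[OF int[of 1]] by measurable
    moreover have "(\<lambda>t. exp t * (exp (- 1 * t) * f t)) = f"
      by (simp add: fun_eq_iff flip: mult.assoc exp_add)
    ultimately show ?thesis by simp
  qed
  \<comment> \<open>Integrating the exponential series of exp(-(z - c) t) termwise gives a power
    series about the real point c that converges on the ball of radius c, the largest one inside the
    half-plane.\<close>
  have ball: "?G holomorphic_on ball (of_real c) c" if c: "0 < c" for c :: real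
  proof (rule power_series_holomorphic)
    fix w assume "w \<in> ball (complex_of_real c) c"
    then have rho: "norm (w - of_real c) < c" (is "?\<rho> < c")
      by (simp add: dist_norm norm_minus_commute)
    define u where "u n t = (exp (- complex_of_real c * of_real t) * of_real (f t)) * ((- of_real t) ^ n /\<^sub>R fact n * (w - of_real c) ^ n)" for n :: nat and t :: real
    have nu: "norm (u n t) = exp (-c * t) * \<bar>f t\<bar> * ((?\<rho> * \<bar>t\<bar>) ^ n /\<^sub>R fact n)" for n t
      by (simp add: u_def norm_mult norm_power power_mult_distrib field_simps)
    have D: "integrable lborel (\<lambda>t. exp (- (c - ?\<rho>) * t) * \<bar>f t\<bar>)"
      using integrable_abs[OF int[of "c - ?\<rho>"]] rho by (simp add: abs_mult)
    \<comment> \<open>One integrable function dominates all partial sums: the series for exp(\<rho>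
      t) only lowers the decay rate from c to c - \<rho>, which is still positive.\<close>
    have partial: "(\<Sum>i<n. norm (u i t)) \<le> exp (- (c - ?\<rho>) * t) * \<bar>f t\<bar>" for n t
    proof (cases "t < 0")
      case True then show ?thesis by (simp add: nu neg)
    next
      case False
      have "(\<Sum>i<n. norm (u i t)) = exp (-c * t) * \<bar>f t\<bar> * (\<Sum>i<n. (?\<rho> * \<bar>t\<bar>) ^ i /\<^sub>R fact i)"
        by (simp add: nu sum_distrib_left)
      also have "(\<Sum>i<n. (?\<rho> * \<bar>t\<bar>) ^ i /\<^sub>R fact i) \<le> exp (?\<rho> * \<bar>t\<bar>)"
        unfolding exp_def by (intro sum_le_suminf summable_exp_generic) auto
      finally have "(\<Sum>i<n. norm (u i t)) \<le> exp (-c * t) * \<bar>f t\<bar> * exp (?\<rho> * \<bar>t\<bar>)"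
        by (simp add: mult_left_mono)
      also have "\<dots> = exp (- (c - ?\<rho>) * t) * \<bar>f t\<bar>"
        using False by (simp add: algebra_simps flip: exp_add)
      finally show ?thesis .
    qed
    have [measurable]: "u n \<in> borel_measurable lborel" for n
      unfolding u_def by measurable
    have ui: "integrable lborel (u n)" for n
    proof (rule Bochner_Integration.integrable_bound[OF D])
      show "AE t in lborel. norm (u n t) \<le> norm (exp (- (c - ?\<rho>) * t) * \<bar>f t\<bar>)"
      proof (rule AE_I2)
        fix t
        have "norm (u n t) \<le> (\<Sum>i<Suc n. norm (u i t))"
          by (simp add: sum_nonneg)
        then show "norm (u n t) \<le> norm (exp (- (c - ?\<rho>) * t) * \<bar>f t\<bar>)"
          using partial[where n="Suc n" and t=t] by simp
      qed
    qed measurable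
    have sums: "(\<lambda>n. u n t) sums (exp (- w * of_real t) * of_real (f t))" for t
    proof -
      have "(\<lambda>n. (- of_real t * (w - of_real c)) ^ n /\<^sub>R fact n) sums exp (- of_real t * (w - of_real c))"
        by (rule exp_converges)
      then have "(\<lambda>n. (exp (- complex_of_real c * of_real t) * of_real (f t)) * ((- of_real t * (w - of_real c)) ^ n /\<^sub>R fact n))
        sums ((exp (- complex_of_real c * of_real t) * of_real (f t)) * exp (- of_real t * (w - of_real c)))"
        by (rule sums_mult)
      also have "(\<lambda>n. (exp (- complex_of_real c * of_real t) * of_real (f t)) * ((- of_real t * (w - of_real c)) ^ n /\<^sub>R fact n)) = (\<lambda>n. u n t)"
        unfolding u_def power_mult_distrib by simp
      also have "(exp (- complex_of_real c * of_real t) * of_real (f t)) * exp (- of_real t * (w - of_real c))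
        = exp (- w * of_real t) * of_real (f t)"
        by (simp add: algebra_simps flip: exp_add)
      finally show ?thesis .
    qed
    have "(\<lambda>n. CLINT t|lborel. u n t) sums (CLINT t|lborel. (\<Sum>n. u n t))"
    proof (rule sums_integral[OF ui])
      have *: "summable (\<lambda>n. norm (u n t))" for t
        by (rule summableI_nonneg_bounded[where x="exp (- (c - ?\<rho>) * t) * \<bar>f t\<bar>"]) (use partial in auto)
      then show "AE t in lborel. summable (\<lambda>n. norm (u n t))" by simp
      show "summable (\<lambda>n. LINT t|lborel. norm (u n t))"
      proof (rule summableI_nonneg_bounded)
        fix n
        have "(\<Sum>i<n. LINT t|lborel. norm (u i t)) = (LINT t|lborel. (\<Sum>i<n. norm (u i t)))"
          using ui by (intro Bochner_Integration.integral_sum[symmetric]) auto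
        also have "\<dots> \<le> (LINT t|lborel. exp (- (c - ?\<rho>) * t) * \<bar>f t\<bar>)"
          using ui by (intro integral_mono D partial) auto
        finally show "(\<Sum>i<n. LINT t|lborel. norm (u i t)) \<le> (LINT t|lborel. exp (- (c - ?\<rho>) * t) * \<bar>f t\<bar>)" .
      qed auto
    qed
    also have "(CLINT t|lborel. (\<Sum>n. u n t)) = ?G w"
      using sums by (simp add: sums_iff)
    also have "(\<lambda>n. CLINT t|lborel. u n t) = (\<lambda>n. (CLINT t|lborel. (exp (- complex_of_real c * of_real t) * of_real (f t)) * ((- of_real t) ^ n /\<^sub>R fact n)) * (w - of_real c) ^ n)"
      unfolding u_def mult.assoc[symmetric] by simp
    finally show "(\<lambda>n. (CLINT t|lborel. (exp (- complex_of_real c * of_real t) * of_real (f t)) * ((- of_real t) ^ n /\<^sub>R fact n)) * (w - of_real c) ^ n) sums ?G w" .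
  qed
  have "?G holomorphic_on (\<Union>c\<in>{0<..}. ball (complex_of_real c) c)"
    by (intro holomorphic_on_UN_open ball) auto
  moreover have "{z. 0 < Re z} \<subseteq> (\<Union>c\<in>{0<..}. ball (complex_of_real c) c)"
  proof
    fix z :: complex assume z: "z \<in> {z. 0 < Re z}"
    \<comment> \<open>z lies in the ball of radius c about c exactly when |z|^2 < 2 c Re z; this
      choice makes the right-hand side 2 |z|^2.\<close>
    define c where "c = (cmod z)\<^sup>2 / Re z"
    have nz: "cmod z > 0" using z by auto
    have c: "0 < c" using z nz by (simp add: c_def)
    have "(cmod (z - of_real c))\<^sup>2 = (cmod z)\<^sup>2 - 2 * c * Re z + c\<^sup>2"
      unfolding cmod_power2 by (simp add: power2_eq_square algebra_simps)
    also have "\<dots> < c\<^sup>2"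
      using z nz by (simp add: c_def)
    finally have "cmod (z - of_real c) < c"
      using c by (simp add: power2_less_imp_less)
    then show "z \<in> (\<Union>c\<in>{0<..}. ball (complex_of_real c) c)"
      using c by (auto simp: dist_norm norm_minus_commute)
  qed
  ultimately show ?thesis by (rule holomorphic_on_subset)
qed

section \<open>Laplace inversion and contour shift\<close>

text \<open>Bromwich's formula at every s. The factor exp(-delta t) makes f integrable, division by
  its mass \<open>m\<close> makes it a density, and \<open>mono\<close> takes over the part that
  continuity of f would usually play.\<close>

lemma laplace_inversion:
  fixes f :: "real \<Rightarrow> real" and \<nu> :: real
  assumes nonneg: "\<And>t. 0 \<le> f t" and [measurable]: "f \<in> borel_measurable borel"
    and mono: "mono (\<lambda>t. exp (\<nu> * t) * f t)"
    and int: "integrable lborel (\<lambda>t. exp (- \<delta> * t) * f t)"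
    and pos: "0 < (LINT t|lborel. exp (- \<delta> * t) * f t)"
    and nn: "0 \<le> \<delta> + \<nu>"
    and intG: "integrable lborel (\<lambda>y. CLINT t|lborel. exp (- Complex \<delta> y * of_real t) * of_real (f t))"
  shows "complex_of_real (f s) = 1 / (2 * pi) * (CLINT y|lborel.
           exp (of_real s * Complex \<delta> y) * (CLINT t|lborel. exp (- Complex \<delta> y * of_real t) * of_real (f t)))"
proof -
  define G where "G y = (CLINT t|lborel. exp (- Complex \<delta> y * of_real t) * of_real (f t))" for y
  define m where "m = (LINT t|lborel. exp (- \<delta> * t) * f t)"
  define g where "g t = exp (- \<delta> * t) * f t / m" for t
  have m: "0 < m" using pos by (simp add: m_def)
  have g0: "0 \<le> g t" for t using nonneg m by (simp add: g_def)
  have gi: "integrable lborel g" unfolding g_def using int by auto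
  have [measurable]: "g \<in> borel_measurable borel" unfolding g_def by measurable
  have g1: "(LINT t|lborel. g t) = 1" unfolding g_def using m by (simp add: m_def)
  define \<mu> where "\<mu> = density lborel (\<lambda>t. ennreal (g t))"
  have "emeasure \<mu> UNIV = (\<integral>\<^sup>+t. ennreal (g t) \<partial>lborel)"
    unfolding \<mu>_def by (subst emeasure_density) auto
  also have "\<dots> = 1"
    using g1 g0 gi by (simp add: nn_integral_eq_integral)
  finally interpret \<mu>: real_distribution \<mu>
    by (intro real_distribution.intro prob_spaceI real_distribution_axioms.intro) (auto simp: \<mu>_def)
  have atom: "measure \<mu> {x} = 0" for x
  proof -
    have "emeasure \<mu> {x} = (\<integral>\<^sup>+t. ennreal (g t) * indicator {x} t \<partial>lborel)"
      unfolding \<mu>_def by (subst emeasure_density) auto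
    also have "\<dots> = 0"
      by (subst nn_integral_0_iff_AE) (use AE_lborel_singleton[of x] in \<open>auto simp: indicator_def\<close>)
    finally show ?thesis by (simp add: measure_def)
  qed
  \<comment> \<open>The sign flips because the Laplace kernel contains exp(-iyt) and the
    characteristic function exp(iyt).\<close>
  have char_eq: "char \<mu> t = G (- t) / m" for t
  proof -
    have "char \<mu> t = (CLINT x|lborel. g x *\<^sub>R iexp (t * x))"
      unfolding char_def \<mu>_def using g0 by (subst integral_density) auto
    also have "\<dots> = (CLINT x|lborel. exp (- Complex \<delta> (- t) * of_real x) * of_real (f x) / m)"
    proof (intro Bochner_Integration.integral_cong refl)
      fix x
      have "- Complex \<delta> (- t) * of_real x = of_real (- \<delta> * x) + \<i> * of_real (t * x)"
        by (simp add: complex_eq_iff)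
      then show "g x *\<^sub>R iexp (t * x) = exp (- Complex \<delta> (- t) * of_real x) * of_real (f x) / m"
        by (simp only: exp_add exp_of_real) (simp add: g_def scaleR_conv_of_real)
    qed
    also have "\<dots> = G (- t) / m" unfolding G_def by (rule integral_divide_zero)
    finally show ?thesis .
  qed
  have intG': "integrable lborel G" using intG by (simp add: G_def[abs_def])
  have int_char: "integrable lborel (char \<mu>)"
  proof -
    have "integrable lborel (\<lambda>t. G (0 + (- 1) * t) / m)"
      using intG' by (intro integrable_divide lborel_integrable_real_affine) auto
    then show ?thesis by (simp add: char_eq[abs_def])
  qed
  define l where "l = 1 / (2 * pi) * (CLINT t|lborel. iexp (-(t * s)) * char \<mu> t)"
  have meas: "measure \<mu> {a<..b} = (LINT t:{a<..b}|lborel. g t)" for a b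
  proof -
    have "emeasure \<mu> {a<..b} = (\<integral>\<^sup>+t. ennreal (indicator {a<..b} t * g t) \<partial>lborel)"
      unfolding \<mu>_def by (subst emeasure_density) (auto intro!: nn_integral_cong simp: indicator_def)
    also have "\<dots> = ennreal (LINT t|lborel. indicator {a<..b} t * g t)"
      using g0 integrable_mult_indicator[OF _ gi, of "{a<..b}"]
      by (intro nn_integral_eq_integral) auto
    finally show ?thesis
      using g0 by (simp add: measure_def set_lebesgue_integral_def integral_nonneg_AE)
  qed
  have set_int: "set_integrable lborel A g" if "A \<in> sets borel" for A
    using gi that unfolding set_integrable_def by (intro integrable_mult_indicator) auto
  \<comment> \<open>From left to right \<open>g\<close> drops by at most an exponential factor,
    being the nondecreasing function exp(nu t) f(t) times a multiple of exp(-(delta + nu)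
    t).\<close>
  have g_le: "g u \<le> g v * exp ((\<delta> + \<nu>) * (v - u))" if "u \<le> v" for u v
  proof -
    have "exp (\<nu> * u) * f u \<le> exp (\<nu> * v) * f v"
      using mono that by (auto dest: monoD)
    then have "exp (- (\<delta> + \<nu>) * u) / m * (exp (\<nu> * u) * f u) \<le> exp (- (\<delta> + \<nu>) * u) / m * (exp (\<nu> * v) * f v)"
      using m by (intro mult_left_mono) auto
    also have "exp (- (\<delta> + \<nu>) * u) / m * (exp (\<nu> * u) * f u) = g u"
      by (simp add: g_def algebra_simps flip: exp_add)
    also have "exp (- (\<delta> + \<nu>) * u) / m * (exp (\<nu> * v) * f v) = g v * exp ((\<delta> + \<nu>) * (v - u))"
      by (simp add: g_def algebra_simps flip: exp_add)
    finally show ?thesis .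
  qed
  define h where "h n = inverse (real (Suc n))" for n
  have h: "0 < h n" for n by (simp add: h_def)
  have h0: "h \<longlonglongrightarrow> 0" unfolding h_def by (rule LIMSEQ_inverse_real_of_nat)
  \<comment> \<open>The averages of \<open>g\<close> over (s, s + h] and over (s - h, s] have the
    common limit \<open>l\<close>. By \<open>le1\<close> the former are asymptotically at least
    g(s), by \<open>le2\<close> the latter at most g(s), which forces l = g(s).\<close>
  have right: "(\<lambda>n. complex_of_real (measure \<mu> {s<..s + h n} / (s + h n - s))) \<longlonglongrightarrow> l"
    unfolding l_def by (rule \<mu>.measure_Ioc_quotient_tendsto[OF int_char atom])
      (use h tendsto_add[OF tendsto_const[of s] h0] in auto)
  have left: "(\<lambda>n. complex_of_real (measure \<mu> {s - h n<..s} / (s - (s - h n)))) \<longlonglongrightarrow> l"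
    unfolding l_def by (rule \<mu>.measure_Ioc_quotient_tendsto[OF int_char atom])
      (use h tendsto_diff[OF tendsto_const[of s] h0] in auto)
  have le1: "g s * exp (- ((\<delta> + \<nu>) * h n)) \<le> measure \<mu> {s<..s + h n} / (s + h n - s)" for n
  proof -
    have "(LINT t:{s<..s + h n}|lborel. g s * exp (- ((\<delta> + \<nu>) * h n))) \<le> (LINT t:{s<..s + h n}|lborel. g t)"
    proof (rule set_integral_mono[OF _ set_int])
      fix t assume t: "t \<in> {s<..s + h n}"
      have "g s \<le> g t * exp ((\<delta> + \<nu>) * (t - s))" using t by (intro g_le) auto
      also have "\<dots> \<le> g t * exp ((\<delta> + \<nu>) * h n)"
        using t nn g0 by (intro mult_left_mono) (auto intro: mult_left_mono)
      finally show "g s * exp (- ((\<delta> + \<nu>) * h n)) \<le> g t"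
        by (simp add: exp_minus pos_divide_le_eq flip: divide_inverse)
    qed (use less_imp_le[OF h[of n]] in \<open>auto simp: set_integrable_def\<close>)
    then show ?thesis using h[of n] by (simp add: meas set_lebesgue_integral_def field_simps)
  qed
  have le2: "measure \<mu> {s - h n<..s} / (s - (s - h n)) \<le> g s * exp ((\<delta> + \<nu>) * h n)" for n
  proof -
    have "(LINT t:{s - h n<..s}|lborel. g t) \<le> (LINT t:{s - h n<..s}|lborel. g s * exp ((\<delta> + \<nu>) * h n))"
    proof (rule set_integral_mono[OF set_int])
      fix t assume t: "t \<in> {s - h n<..s}"
      have "g t \<le> g s * exp ((\<delta> + \<nu>) * (s - t))" using t by (intro g_le) auto
      also have "\<dots> \<le> g s * exp ((\<delta> + \<nu>) * h n)"
        using t nn g0 by (intro mult_left_mono) (auto intro: mult_left_mono)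
      finally show "g t \<le> g s * exp ((\<delta> + \<nu>) * h n)" .
    qed (use less_imp_le[OF h[of n]] in \<open>auto simp: set_integrable_def\<close>)
    then show ?thesis using h[of n] by (simp add: meas set_lebesgue_integral_def field_simps)
  qed
  have "(\<lambda>n. g s * exp (- ((\<delta> + \<nu>) * h n))) \<longlonglongrightarrow> g s * exp (- ((\<delta> + \<nu>) * 0))"
    by (intro tendsto_intros h0)
  then have "g s * exp (- ((\<delta> + \<nu>) * 0)) \<le> Re l"
    by (rule LIMSEQ_le[OF _ tendsto_Re[OF right]]) (use le1 in auto)
  moreover have "(\<lambda>n. g s * exp ((\<delta> + \<nu>) * h n)) \<longlonglongrightarrow> g s * exp ((\<delta> + \<nu>) * 0)"
    by (intro tendsto_intros h0)
  then have "Re l \<le> g s * exp ((\<delta> + \<nu>) * 0)"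
    by (rule LIMSEQ_le[OF tendsto_Re[OF left]]) (use le2 in auto)
  ultimately have Rel: "Re l = g s" by simp
  have "Im l = 0"
    using tendsto_Im[OF left] by (simp add: LIMSEQ_const_iff)
  with Rel have l: "l = of_real (g s)" by (simp add: complex_eq_iff)
  \<comment> \<open>Reflecting t to -t returns to the Laplace transform on the line; the factor
    \<open>m * exp (\<delta> * s)\<close> undoes the normalisation.\<close>
  have "l = 1 / (2 * pi) * (CLINT t|lborel. (iexp (s * (0 + (- 1) * t)) * G (0 + (- 1) * t)) / m)"
    by (simp add: l_def char_eq mult.commute)
  also have "\<dots> = 1 / (2 * pi) * ((CLINT t|lborel. iexp (s * (0 + (- 1) * t)) * G (0 + (- 1) * t)) / m)"
    unfolding integral_divide_zero ..
  also have "(CLINT t|lborel. iexp (s * (0 + (- 1) * t)) * G (0 + (- 1) * t)) = (CLINT y|lborel. iexp (s * y) * G y)"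
    using lborel_integral_real_affine[of "- 1" "\<lambda>y. iexp (s * y) * G y" 0] by simp
  finally have "m * exp (\<delta> * s) * of_real (g s) = 1 / (2 * pi) * (exp (\<delta> * s) * (CLINT y|lborel. iexp (s * y) * G y))"
    using m l by (simp add: field_simps)
  also have "m * exp (\<delta> * s) * of_real (g s) = of_real (m * exp (\<delta> * s) * g s)" by simp
  also have "m * exp (\<delta> * s) * g s = f s"
    using m by (simp add: g_def flip: exp_add)
  also have "exp (\<delta> * s) * (CLINT y|lborel. iexp (s * y) * G y) = (CLINT y|lborel. exp (\<delta> * s) * (iexp (s * y) * G y))"
    by (rule integral_mult_right_zero[symmetric])
  also have "\<dots> = (CLINT y|lborel. exp (of_real s * Complex \<delta> y) * G y)"
  proof (intro Bochner_Integration.integral_cong refl)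
    fix y
    have "of_real s * Complex \<delta> y = of_real (\<delta> * s) + \<i> * of_real (s * y)"
      by (simp add: complex_eq_iff)
    then show "exp (\<delta> * s) * (iexp (s * y) * G y) = exp (of_real s * Complex \<delta> y) * G y"
      by (simp only: exp_add exp_of_real) (simp add: exp_of_real)
  qed
  finally show ?thesis by (simp add: G_def)
qed

text \<open>Residue theorem on rectangles with real parts -delta, delta and imaginary parts -R, R.
  The horizontal edges keep the length 2 delta while the integrand decays uniformly on them, and the
  vertical edges exhaust the two lines. The margin epsilon keeps these lines inside the open
  strip.\<close>

lemma vertical_contour_shift:
  fixes H :: "complex \<Rightarrow> complex" and \<delta> \<epsilon> :: real
  assumes \<delta>: "0 < \<delta>" and \<epsilon>: "0 < \<epsilon>"
    and holo: "H holomorphic_on ({z. \<bar>Re z\<bar> < \<delta> + \<epsilon>} - {0})"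
    and intR: "integrable lborel (\<lambda>y. H (Complex \<delta> y))"
    and intL: "integrable lborel (\<lambda>y. H (Complex (- \<delta>) y))"
    and top: "uniform_limit {-\<delta>..\<delta>} (\<lambda>y u. H (Complex u y)) (\<lambda>u. 0) at_top"
    and bot: "uniform_limit {-\<delta>..\<delta>} (\<lambda>y u. H (Complex u y)) (\<lambda>u. 0) at_bot"
  shows "(CLINT y|lborel. H (Complex \<delta> y)) - (CLINT y|lborel. H (Complex (- \<delta>) y)) = 2 * pi * residue H 0"
proof -
  let ?S = "{z. \<bar>Re z\<bar> < \<delta> + \<epsilon>}"
  have S: "?S = {z. Re z < \<delta> + \<epsilon>} \<inter> {z. Re z > - (\<delta> + \<epsilon>)}" by auto
  have openS: "open ?S" unfolding S by (intro open_Int open_halfspace_Re_lt open_halfspace_Re_gt)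
  have connS: "connected ?S" unfolding S
    by (intro convex_connected convex_Int convex_halfspace_Re_lt convex_halfspace_Re_gt)
  have cont: "continuous_on (?S - {0}) H" using holo by (rule holomorphic_on_imp_continuous_on)
  define B where "B y = contour_integral (linepath (Complex (- \<delta>) y) (Complex \<delta> y)) H" for y
  define V where "V c n = (CLINT y:{- real (Suc n)..real (Suc n)}|lborel. H (Complex c y))" for c and n :: nat
  have ci: "H contour_integrable_on linepath a b" if "closed_segment a b \<subseteq> ?S - {0}" for a b
    using that cont by (intro contour_integrable_continuous_linepath) (rule continuous_on_subset)
  have segV: "closed_segment (Complex c y) (Complex c y') \<subseteq> ?S - {0}" if "c = \<delta> \<or> c = - \<delta>" for c y y'
    using that \<delta> \<epsilon> by (cases "y \<le> y'") (auto simp: closed_segment_same_Re)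
  have segB: "closed_segment (Complex (- \<delta>) y) (Complex \<delta> y) \<subseteq> ?S - {0}"
    "closed_segment (Complex \<delta> y) (Complex (- \<delta>) y) \<subseteq> ?S - {0}" if "y \<noteq> 0" for y
    using that \<delta> \<epsilon> by (auto simp: closed_segment_same_Im closed_segment_eq_real_ivl)
  have vert: "contour_integral (linepath (Complex c (- real (Suc n))) (Complex c (real (Suc n)))) H = \<i> * V c n"
    if "c = \<delta> \<or> c = - \<delta>" for c n
  proof -
    have "set_integrable lborel {- real (Suc n)..real (Suc n)} (\<lambda>y. H (Complex c y))"
      using that intR intL unfolding set_integrable_def by (auto intro!: integrable_mult_indicator)
    then show ?thesis
      unfolding V_def
      by (subst contour_integral_linepath_same_Re[where c=c and a="- real (Suc n)" and b="real (Suc n)"])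
         (simp_all add: set_borel_integral_eq_integral(2))
  qed
  have eq: "B (- real (Suc n)) + \<i> * V \<delta> n - B (real (Suc n)) - \<i> * V (- \<delta>) n = 2 * pi * \<i> * residue H 0" for n
  proof -
    \<comment> \<open>R is n + 1 rather than n, so that the horizontal edges never meet the
      singularity at 0.\<close>
    define R where "R = real (Suc n)"
    have R: "0 < R" by (simp add: R_def)
    let ?g = "rectpath (Complex (- \<delta>) (- R)) (Complex \<delta> R)"
    have gS: "path_image ?g \<subseteq> ?S - {0}"
      using \<delta> \<epsilon> R by (auto simp: path_image_rectpath closed_segment_same_Re)
    have sum: "contour_integral ?g H = 2 * pi * \<i> * (\<Sum>p\<in>{0}. winding_number ?g p * residue H p)"
    proof (rule Residue_theorem[OF openS connS _ holo])
      show "\<forall>z. z \<notin> ?S \<longrightarrow> winding_number ?g z = 0"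
        using \<delta> \<epsilon> R by (auto intro!: winding_number_rectpath_outside simp: in_cbox_complex_iff)
    qed (use gS in auto)
    have "winding_number ?g 0 = 1"
      using \<delta> R by (intro winding_number_rectpath) (auto simp: in_box_complex_iff)
    with sum have res: "contour_integral ?g H = 2 * pi * \<i> * residue H 0" by simp
    have "(H has_contour_integral
       (contour_integral (linepath (Complex (- \<delta>) (- R)) (Complex \<delta> (- R))) H +
       (contour_integral (linepath (Complex \<delta> (- R)) (Complex \<delta> R)) H +
       (contour_integral (linepath (Complex \<delta> R) (Complex (- \<delta>) R)) H +
        contour_integral (linepath (Complex (- \<delta>) R) (Complex (- \<delta>) (- R))) H)))) ?g"
      unfolding rectpath_def Let_def complex.sel
      by (intro has_contour_integral_join has_contour_integral_integral ci segV segB valid_path_join valid_path_linepath)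
         (use R in auto)
    then have "contour_integral ?g H = B (- R) + \<i> * V \<delta> n +
       (contour_integral (linepath (Complex \<delta> R) (Complex (- \<delta>) R)) H +
        contour_integral (linepath (Complex (- \<delta>) R) (Complex (- \<delta>) (- R))) H)"
      using vert[of \<delta> n] by (simp add: contour_integral_unique B_def R_def)
    also have "contour_integral (linepath (Complex \<delta> R) (Complex (- \<delta>) R)) H = - B R"
      unfolding B_def reversepath_linepath[of "Complex (- \<delta>) R", symmetric]
      by (rule contour_integral_reversepath) simp
    also have "contour_integral (linepath (Complex (- \<delta>) R) (Complex (- \<delta>) (- R))) H = - (\<i> * V (- \<delta>) n)"
      unfolding vert[of "- \<delta>" n, OF disjI2[OF refl], symmetric] R_def
      by (rule contour_integral_reversepath[OF valid_path_linepath, unfolded reversepath_linepath])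
    finally show ?thesis using res by (simp add: R_def algebra_simps)
  qed
  \<comment> \<open>On an edge of length 2 delta, the bound e / (4 delta) for the integrand gives e
    / 2 for the integral.\<close>
  have Blim: "(\<lambda>n. B (f n)) \<longlonglongrightarrow> 0"
    if ul: "uniform_limit {-\<delta>..\<delta>} (\<lambda>n u. H (Complex u (f n))) (\<lambda>u. 0) sequentially"
      and f: "\<And>n. f n \<noteq> 0" for f :: "nat \<Rightarrow> real"
  proof (rule tendstoI)
    fix e :: real assume e: "0 < e"
    have "\<forall>\<^sub>F n in sequentially. \<forall>u\<in>{-\<delta>..\<delta>}. dist (H (Complex u (f n))) 0 < e / (4 * \<delta>)"
      using uniform_limitD[OF ul, of "e / (4 * \<delta>)"] e \<delta> by simp
    then show "\<forall>\<^sub>F n in sequentially. dist (B (f n)) 0 < e"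
    proof eventually_elim
      case (elim n)
      have "norm (B (f n)) \<le> e / (4 * \<delta>) * norm (Complex \<delta> (f n) - Complex (- \<delta>) (f n))"
        unfolding B_def
      proof (rule contour_integral_bound_linepath[OF ci[OF segB(1)[OF f]]])
        fix x assume "x \<in> closed_segment (Complex (- \<delta>) (f n)) (Complex \<delta> (f n))"
        then have "x = Complex (Re x) (f n)" "Re x \<in> {-\<delta>..\<delta>}"
          using \<delta> by (auto simp: closed_segment_same_Im closed_segment_eq_real_ivl complex_eq_iff)
        then show "norm (H x) \<le> e / (4 * \<delta>)"
          using elim by (metis dist_0_norm dist_commute less_imp_le)
      qed (use e \<delta> in auto)
      also have "Complex \<delta> (f n) - Complex (- \<delta>) (f n) = of_real (2 * \<delta>)"
        by (simp add: complex_eq_iff)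
      also have "e / (4 * \<delta>) * norm (complex_of_real (2 * \<delta>)) = e / 2"
        using \<delta> by (subst norm_of_real) simp
      finally show ?case using e by simp
    qed
  qed
  have Suc_top: "filterlim (\<lambda>n. real (Suc n)) at_top sequentially"
    by (rule filterlim_compose[OF filterlim_real_sequentially filterlim_Suc])
  have "(\<lambda>n. B (real (Suc n))) \<longlonglongrightarrow> 0"
    by (rule Blim[OF filterlim_compose[OF top Suc_top]]) simp
  moreover have "(\<lambda>n. B (- real (Suc n))) \<longlonglongrightarrow> 0"
    by (rule Blim[OF filterlim_compose[OF bot filterlim_compose[OF filterlim_uminus_at_bot_at_top Suc_top]]]) simp
  moreover have Vlim: "V c \<longlonglongrightarrow> (CLINT y|lborel. H (Complex c y))"
    if "integrable lborel (\<lambda>y. H (Complex c y))" for c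
  proof -
    have U: "(\<Union>n. {- real (Suc n)..real (Suc n)}) = UNIV"
    proof -
      have "\<exists>n. x \<in> {- real (Suc n)..real (Suc n)}" for x
      proof -
        obtain m :: nat where "\<bar>x\<bar> < real m" using reals_Archimedean2 by blast
        then show ?thesis by (intro exI[of _ m]) auto
      qed
      then show ?thesis by auto
    qed
    have "V c \<longlonglongrightarrow> (CLINT y:(\<Union>n. {- real (Suc n)..real (Suc n)})|lborel. H (Complex c y))"
      unfolding V_def
    proof (rule set_integral_cont_up)
      show "set_integrable lborel (\<Union>n. {- real (Suc n)..real (Suc n)}) (\<lambda>y. H (Complex c y))"
        unfolding U set_integrable_def using that by simp
    qed (auto simp: incseq_def)
    then show ?thesis unfolding U by (simp add: set_lebesgue_integral_def)
  qed
  ultimately have "(\<lambda>n. B (- real (Suc n)) + \<i> * V \<delta> n - B (real (Suc n)) - \<i> * V (- \<delta>) n)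
    \<longlonglongrightarrow> 0 + \<i> * (CLINT y|lborel. H (Complex \<delta> y)) - 0 - \<i> * (CLINT y|lborel. H (Complex (- \<delta>) y))"
    by (intro tendsto_intros Vlim intR intL)
  then have "\<i> * (CLINT y|lborel. H (Complex \<delta> y)) - \<i> * (CLINT y|lborel. H (Complex (- \<delta>) y)) = 2 * pi * \<i> * residue H 0"
    unfolding eq by (simp add: LIMSEQ_const_iff)
  then have "\<i> * ((CLINT y|lborel. H (Complex \<delta> y)) - (CLINT y|lborel. H (Complex (- \<delta>) y))) = \<i> * (2 * pi * residue H 0)"
    by (simp add: algebra_simps)
  then show ?thesis by simp
qed

text \<open>The inversion integral is moved from Re z = delta to Re z = -delta, where exp(sz) has
  modulus exp(-delta s) whatever the sign of s. What has to be supplied is that \<open>F\<close> is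
  the transform itself on the line Re z = delta, and that the transform does not vanish there, so
  that normalisation is possible.\<close>

lemma laplace_asymptotics:
  fixes f :: "real \<Rightarrow> real" and \<nu> \<delta> \<epsilon> c :: real
  assumes nonneg: "\<And>t. 0 \<le> f t" and neg: "\<And>t. t < 0 \<Longrightarrow> f t = 0"
    and meas [measurable]: "f \<in> borel_measurable borel"
    and mono: "mono (\<lambda>t. exp (\<nu> * t) * f t)" and \<nu>: "0 \<le> \<nu>"
    and \<delta>: "0 < \<delta>" and \<epsilon>: "0 < \<epsilon>"
    and ext: "analytic_extension (laplace (\<lambda>t. ennreal (f t))) \<delta> \<epsilon> F c"
  shows "0 < c" and "\<bar>f s - c\<bar> \<le> exp (- \<delta> * s) * \<Psi>\<^sub>0 \<delta> F / (2 * pi)"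
proof -
  let ?L = "laplace (\<lambda>t. ennreal (f t))"
  let ?S = "{z::complex. \<bar>Re z\<bar> < \<delta> + \<epsilon>}"
  have L_fin: "?L \<gamma> < \<infinity>" and F_L: "F (of_real \<gamma>) = of_real (enn2real (?L \<gamma>))" if "0 < \<gamma>" for \<gamma>
    using ext that unfolding analytic_extension_def by blast+
  have an: "F analytic_on (?S - {0})" and pole: "is_pole F 0" and zo: "zorder F 0 = -1"
    and resF: "residue F 0 = of_real c"
    and intR: "integrable lborel (\<lambda>y. norm (F (Complex \<delta> y)))"
    and intL: "integrable lborel (\<lambda>y. norm (F (Complex (- \<delta>) y)))"
    and top: "uniform_limit {-\<delta>..\<delta>} (\<lambda>y u. F (Complex u y)) (\<lambda>u. 0) at_top"
    and bot: "uniform_limit {-\<delta>..\<delta>} (\<lambda>y u. F (Complex u y)) (\<lambda>u. 0) at_bot"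
    using ext unfolding analytic_extension_def by blast+
  have holo: "F holomorphic_on (?S - {0})" using an by (rule analytic_imp_holomorphic)
  have S: "?S = {z. Re z < \<delta> + \<epsilon>} \<inter> {z. Re z > - (\<delta> + \<epsilon>)}" by auto
  have openS: "open ?S" unfolding S by (intro open_Int open_halfspace_Re_lt open_halfspace_Re_gt)
  have L_eq: "?L \<gamma> = (\<integral>\<^sup>+t. ennreal (exp (- \<gamma> * t) * f t) \<partial>lborel)" for \<gamma>
    unfolding laplace_def using nonneg
    by (intro nn_integral_cong) (auto simp: indicator_def neg ennreal_mult)
  have int: "integrable lborel (\<lambda>t. exp (- \<gamma> * t) * f t)" if "0 < \<gamma>" for \<gamma>
    using L_fin[OF that] nonneg unfolding L_eq by (intro integrableI_nonneg) auto
  have F_real: "F (of_real \<gamma>) = of_real (LINT t|lborel. exp (- \<gamma> * t) * f t)" if "0 < \<gamma>" for \<gamma>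
    unfolding F_L[OF that] L_eq using nonneg int[OF that]
    by (subst nn_integral_eq_integral) (auto simp: integral_nonneg_AE)
  define G where "G z = (CLINT t|lborel. exp (- z * of_real t) * of_real (f t))" for z
  have holoG: "G holomorphic_on {z. 0 < Re z}"
    unfolding G_def by (rule laplace_transform_holomorphic[OF int neg])
  \<comment> \<open>\<open>F\<close> is tied to the transform only on the positive real axis. The
    identity theorem, with the accumulation point delta, spreads the equality over the right half of
    the strip, where both sides are holomorphic.\<close>
  have FG: "F z = G z" if z: "0 < Re z" "Re z < \<delta> + \<epsilon>" for z
  proof -
    let ?T = "{z. Re z > 0} \<inter> {z. Re z < \<delta> + \<epsilon>}"
    let ?U = "complex_of_real ` {0<..<\<delta> + \<epsilon>}"
    have "complex_of_real \<delta> islimpt ?U"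
      using \<delta> \<epsilon> by (intro islimpt_isCont_image) (auto simp: eventually_at_filter intro!: islimpt_greaterThanLessThan1)
    have "F z - G z = 0"
    proof (rule analytic_continuation[of "\<lambda>z. F z - G z" ?T ?U "of_real \<delta>" z])
      show "(\<lambda>z. F z - G z) holomorphic_on ?T"
        by (intro holomorphic_on_diff holomorphic_on_subset[OF holo] holomorphic_on_subset[OF holoG]) auto
      show "open ?T" by (intro open_Int open_halfspace_Re_lt open_halfspace_Re_gt)
      show "connected ?T"
        by (intro convex_connected convex_Int convex_halfspace_Re_lt convex_halfspace_Re_gt)
      show "F w - G w = 0" if w: "w \<in> ?U" for w
      proof -
        from w obtain \<gamma> where \<gamma>: "0 < \<gamma>" "w = of_real \<gamma>" by auto
        have "G w = (CLINT t|lborel. of_real (exp (- \<gamma> * t) * f t))"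
          unfolding G_def \<gamma> by (intro Bochner_Integration.integral_cong) (auto simp: exp_of_real[symmetric])
        then show ?thesis using F_real[OF \<gamma>(1)] \<gamma>(2) by (simp flip: integral_complex_of_real)
      qed
    qed (use z \<delta> \<epsilon> \<open>of_real \<delta> islimpt ?U\<close> in auto)
    then show ?thesis by simp
  qed
  obtain r where r: "0 < r" "zor_poly F 0 holomorphic_on cball 0 r" "zor_poly F 0 0 \<noteq> 0"
    and Fr: "\<And>w. w \<in> cball 0 r - {0} \<Longrightarrow> F w = zor_poly F 0 w / w"
    using zorder_exist_pole[OF holo openS _ pole] zo \<delta> \<epsilon> by auto
  have iso: "isolated_singularity_at F 0"
  proof -
    have "ball 0 \<delta> - {0} \<subseteq> ?S - {0}"
    proof
      fix z assume "z \<in> ball (0::complex) \<delta> - {0}"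
      then show "z \<in> ?S - {0}" using abs_Re_le_cmod[of z] \<epsilon> by simp
    qed
    then show ?thesis
      unfolding isolated_singularity_at_def using analytic_on_subset[OF an] \<delta> by blast
  qed
  have zp: "zor_poly F 0 0 = of_real c"
    using residue_simple_pole[OF iso pole zo] resF by simp
  \<comment> \<open>Near a simple pole at 0, z F(z) is the holomorphic function
    \<open>zor_poly F 0\<close>, whose value at 0 is the residue.\<close>
  have limF: "((\<lambda>w. F w * w) \<longlongrightarrow> of_real c) (at 0)"
  proof -
    have "isCont (zor_poly F 0) 0"
      using holomorphic_on_imp_continuous_on[OF r(2)] r(1)
      by (simp add: continuous_on_interior)
    then have "(zor_poly F 0 \<longlongrightarrow> of_real c) (at 0)"
      by (simp add: isCont_def zp)
    moreover have "\<forall>\<^sub>F w in at 0. w \<in> ball 0 r - {0::complex}"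
      using r(1) by (intro eventually_at_in_open) auto
    then have "\<forall>\<^sub>F w in at 0. zor_poly F 0 w = F w * w"
      by eventually_elim (simp add: Fr)
    ultimately show ?thesis by (rule Lim_transform_eventually)
  qed
  have "filterlim complex_of_real (at 0) (at_right 0)"
    by (auto simp: filterlim_at eventually_at_filter intro!: tendsto_eq_intros)
  note limF_right = filterlim_compose[OF limF this]
  \<comment> \<open>The residue at a pole of order exactly 1 is nonzero. Its sign is read off along
    the positive axis, where \<open>F\<close> is the integral of a nonnegative function.\<close>
  have "c \<noteq> 0" using zp r(3) by auto
  moreover have "0 \<le> c"
  proof -
    have "((\<lambda>\<gamma>. Re (F (of_real \<gamma>) * of_real \<gamma>)) \<longlongrightarrow> c) (at_right 0)"
      using tendsto_Re[OF limF_right] by simp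
    then show "0 \<le> c"
    proof (rule tendsto_lowerbound)
      show "\<forall>\<^sub>F \<gamma> in at_right 0. 0 \<le> Re (F (complex_of_real \<gamma>) * complex_of_real \<gamma>)"
        using eventually_at_right_less[of "0::real"]
        by eventually_elim (simp add: F_real nonneg integral_nonneg_AE)
    qed simp
  qed
  ultimately show c: "0 < c" by simp
  have contV: "continuous_on UNIV (\<lambda>y. F (Complex u y))" if "u = \<delta> \<or> u = - \<delta>" for u
    using that \<delta> \<epsilon>
    by (intro continuous_on_compose2[OF holomorphic_on_imp_continuous_on[OF holo]])
       (auto simp: Complex_eq complex_eq_iff intro!: continuous_intros)
  have intV: "integrable lborel (\<lambda>y. exp (of_real s * Complex u y) * F (Complex u y))" if u: "u = \<delta> \<or> u = - \<delta>" for u s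
  proof (rule Bochner_Integration.integrable_bound[where f="\<lambda>y. exp (s * u) * norm (F (Complex u y))"])
    show "integrable lborel (\<lambda>y. exp (s * u) * norm (F (Complex u y)))"
      using u intR intL by auto
    have [measurable]: "(\<lambda>y. F (Complex u y)) \<in> borel_measurable borel"
      by (rule borel_measurable_continuous_onI[OF contV[OF u]])
    have [measurable]: "(\<lambda>y. exp (of_real s * Complex u y)) \<in> borel_measurable borel"
      by (intro borel_measurable_continuous_onI) (auto simp: Complex_eq intro!: continuous_intros)
    show "(\<lambda>y. exp (of_real s * Complex u y) * F (Complex u y)) \<in> borel_measurable lborel"
      by measurable
  qed (simp add: norm_mult)
  \<comment> \<open>If this integral were 0, f would vanish almost everywhere and \<open>F\<close>
    on the whole positive axis, contradicting the pole.\<close>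
  have pos: "0 < (LINT t|lborel. exp (- \<delta> * t) * f t)"
  proof (rule ccontr)
    assume "\<not> ?thesis"
    then have "(LINT t|lborel. exp (- \<delta> * t) * f t) = 0"
      using nonneg by (intro antisym) (auto intro!: integral_nonneg_AE)
    then have "AE t in lborel. f t = 0"
      using integral_nonneg_eq_0_iff_AE[OF int[OF \<delta>]] nonneg by simp
    then have "(LINT t|lborel. exp (- \<gamma> * t) * f t) = 0" for \<gamma>
      by (intro integral_eq_zero_AE) auto
    then have "F (of_real \<gamma>) * of_real \<gamma> = 0" if "0 < \<gamma>" for \<gamma>
      using F_real[OF that] by simp
    then have "\<forall>\<^sub>F \<gamma> in at_right 0. F (of_real \<gamma>) * of_real \<gamma> = 0"
      by (auto simp: eventually_at_filter)
    from Lim_transform_eventually[OF limF_right this]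
    have "((\<lambda>\<gamma>. 0) \<longlongrightarrow> complex_of_real c) (at_right (0::real))" .
    then show False using c by (simp add: tendsto_const_iff)
  qed
  have FV: "F (Complex \<delta> y) = (CLINT t|lborel. exp (- Complex \<delta> y * of_real t) * of_real (f t))" for y
    using FG[of "Complex \<delta> y"] \<delta> \<epsilon> by (simp add: G_def)
  have inv: "of_real (f s) = 1 / (2 * pi) * (CLINT y|lborel. exp (of_real s * Complex \<delta> y) * F (Complex \<delta> y))"
    unfolding FV
    by (rule laplace_inversion[OF nonneg meas mono int[OF \<delta>] pos])
       (use \<nu> \<delta> intV[of \<delta> 0] in \<open>auto simp: FV\<close>)
  \<comment> \<open>The entire factor exp(sz) equals 1 at 0, so the residue stays c; it is bounded
    for |Re z| \<le> delta, so the uniform decay of \<open>F\<close> is inherited.\<close>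
  define H where "H z = exp (of_real s * z) * F z" for z
  have normH: "norm (H (Complex u y)) \<le> exp (\<bar>s\<bar> * \<delta>) * norm (F (Complex u y))" if "u \<in> {-\<delta>..\<delta>}" for u y
  proof -
    have "\<bar>s * u\<bar> \<le> \<bar>s\<bar> * \<delta>" using that unfolding abs_mult by (intro mult_left_mono) auto
    then show ?thesis by (simp add: H_def norm_mult mult_right_mono)
  qed
  have ulH: "uniform_limit {-\<delta>..\<delta>} (\<lambda>y u. H (Complex u y)) (\<lambda>u. 0) A"
    if ul: "uniform_limit {-\<delta>..\<delta>} (\<lambda>y u. F (Complex u y)) (\<lambda>u. 0) A" for A
  proof (rule uniform_limitI)
    fix e :: real assume e: "0 < e"
    have "\<forall>\<^sub>F y in A. \<forall>u\<in>{-\<delta>..\<delta>}. dist (F (Complex u y)) 0 < e / exp (\<bar>s\<bar> * \<delta>)"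
      using e by (intro uniform_limitD[OF ul]) simp
    then show "\<forall>\<^sub>F y in A. \<forall>u\<in>{-\<delta>..\<delta>}. dist (H (Complex u y)) 0 < e"
    proof eventually_elim
      case (elim y)
      show ?case
      proof
        fix u assume u: "u \<in> {-\<delta>..\<delta>}"
        with elim have "exp (\<bar>s\<bar> * \<delta>) * norm (F (Complex u y)) < e"
          by (simp add: field_simps)
        then show "dist (H (Complex u y)) 0 < e" using normH[OF u, of y] by simp
      qed
    qed
  qed
  have holoH: "H holomorphic_on (?S - {0})"
    unfolding H_def by (intro holomorphic_intros holo)
  have "((\<lambda>w. exp (of_real s * w) * (F w * w)) \<longlongrightarrow> exp (of_real s * 0) * of_real c) (at 0)"
    by (intro tendsto_intros limF)
  then have "residue H 0 = of_real c"
    using \<delta> \<epsilon> by (intro residue_simple'[OF openS _ holoH]) (auto simp: H_def mult.assoc)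
  moreover have "integrable lborel (\<lambda>y. H (Complex u y))" if "u = \<delta> \<or> u = - \<delta>" for u
    unfolding H_def using that by (rule intV)
  ultimately have shift: "(CLINT y|lborel. H (Complex \<delta> y)) = 2 * pi * c + (CLINT y|lborel. H (Complex (- \<delta>) y))"
    using vertical_contour_shift[OF \<delta> \<epsilon> holoH _ _ ulH[OF top] ulH[OF bot]]
    by (simp add: algebra_simps)
  have "of_real (f s) = 1 / (2 * pi) * (CLINT y|lborel. H (Complex \<delta> y))"
    using inv by (simp add: H_def)
  also have "\<dots> = of_real c + 1 / (2 * pi) * (CLINT y|lborel. H (Complex (- \<delta>) y))"
    unfolding shift by (simp add: field_simps)
  finally have "of_real (f s - c) = 1 / (2 * pi) * (CLINT y|lborel. H (Complex (- \<delta>) y))"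
    by simp
  then have "norm (complex_of_real (f s - c)) = 1 / (2 * pi) * norm (CLINT y|lborel. H (Complex (- \<delta>) y))"
    by (simp add: norm_mult norm_divide)
  also have "\<dots> \<le> 1 / (2 * pi) * (LINT y|lborel. norm (H (Complex (- \<delta>) y)))"
    by (intro mult_left_mono integral_norm_bound) auto
  also have "(LINT y|lborel. norm (H (Complex (- \<delta>) y))) = (LINT y|lborel. exp (- \<delta> * s) * norm (F (Complex (- \<delta>) y)))"
    by (simp add: H_def norm_mult mult.commute)
  also have "\<dots> = exp (- \<delta> * s) * \<Psi>\<^sub>0 \<delta> F"
    unfolding \<Psi>\<^sub>0_def by (rule integral_mult_right_zero)
  finally show "\<bar>f s - c\<bar> \<le> exp (- \<delta> * s) * \<Psi>\<^sub>0 \<delta> F / (2 * pi)"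
    by (simp only: norm_of_real) (simp add: field_simps)
qed

section \<open>Counting cells\<close>

lemma (in prob_space) indep_var_nn_integral_mult:
  fixes f :: "'b \<Rightarrow> ennreal" and g :: "'b \<Rightarrow> ennreal"
  assumes indep: "indep_var S X T Y"
    and [measurable]: "f \<in> borel_measurable S" "g \<in> borel_measurable T"
  shows "(\<integral>\<^sup>+\<omega>. f (X \<omega>) * g (Y \<omega>) \<partial>M) = (\<integral>\<^sup>+\<omega>. f (X \<omega>) \<partial>M) * (\<integral>\<^sup>+\<omega>. g (Y \<omega>) \<partial>M)"
proof -
  have [measurable]: "X \<in> M \<rightarrow>\<^sub>M S" "Y \<in> M \<rightarrow>\<^sub>M T"
    and eq: "distr M S X \<Otimes>\<^sub>M distr M T Y = distr M (S \<Otimes>\<^sub>M T) (\<lambda>\<omega>. (X \<omega>, Y \<omega>))"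
    using indep by (auto simp: indep_var_distribution_eq)
  interpret T: prob_space "distr M T Y" by (rule prob_space_distr) measurable
  have "(\<integral>\<^sup>+\<omega>. f (X \<omega>) * g (Y \<omega>) \<partial>M) = (\<integral>\<^sup>+z. f (fst z) * g (snd z) \<partial>(distr M S X \<Otimes>\<^sub>M distr M T Y))"
    unfolding eq by (subst nn_integral_distr) auto
  also have "\<dots> = (\<integral>\<^sup>+x. \<integral>\<^sup>+y. f x * g y \<partial>distr M T Y \<partial>distr M S X)"
    by (subst T.nn_integral_fst[symmetric]) auto
  also have "\<dots> = (\<integral>\<^sup>+x. f x \<partial>distr M S X) * (\<integral>\<^sup>+y. g y \<partial>distr M T Y)"
    by (simp add: nn_integral_cmult nn_integral_multc)
  also have "\<dots> = (\<integral>\<^sup>+\<omega>. f (X \<omega>) \<partial>M) * (\<integral>\<^sup>+\<omega>. g (Y \<omega>) \<partial>M)"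
    by (simp add: nn_integral_distr)
  finally show ?thesis .
qed

text \<open>The bound \<open>d i\<close> depends on the position alone, not on the earlier entries:
  this is the tree in which all cells of a generation share one type, and it makes the count a plain
  product.\<close>

lemma card_bounded_lists:
  fixes d :: "nat \<Rightarrow> nat"
  shows "finite {v. length v = n \<and> (\<forall>i<length v. v ! i \<in> {1..d i})} \<and>
    card {v. length v = n \<and> (\<forall>i<length v. v ! i \<in> {1..d i})} = (\<Prod>i<n. d i)"
proof (induction n)
  case 0
  have "{v::nat list. length v = 0 \<and> (\<forall>i<length v. v ! i \<in> {1..d i})} = {[]}" by auto
  then show ?case by simp
next
  case (Suc n)
  let ?A = "\<lambda>n. {v. length v = n \<and> (\<forall>i<length v. v ! i \<in> {1..d i})}"
  have eq: "?A (Suc n) = (\<lambda>(v, k). v @ [k]) ` (?A n \<times> {1..d n})"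
  proof (intro set_eqI iffI)
    fix v assume v: "v \<in> ?A (Suc n)"
    then have ne: "v \<noteq> []" by auto
    have "butlast v \<in> ?A n" using v by (auto simp: nth_butlast)
    moreover have "last v \<in> {1..d n}" using v ne by (auto simp: last_conv_nth)
    ultimately show "v \<in> (\<lambda>(v, k). v @ [k]) ` (?A n \<times> {1..d n})"
      using ne by (intro image_eqI[of _ _ "(butlast v, last v)"]) auto
  qed (auto simp: nth_append less_Suc_eq)
  have "inj_on (\<lambda>(v, k). v @ [k]) (?A n \<times> {1..d n})" by (auto simp: inj_on_def)
  then show ?case unfolding eq using Suc by (simp add: card_image card_cartesian_product)
qed

context branching_model
begin

text \<open>Being alive as a condition on the types met along one line: \<open>y i\<close> stands
  for the type of the ancestor in generation i. With \<open>y\<close> fixed and \<open>v\<close>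
  varying, it describes a tree with a single type per generation.\<close>

definition alive_along :: "real \<Rightarrow> (nat \<Rightarrow> 'x) \<Rightarrow> nat list \<Rightarrow> bool" where
  "alive_along t y v \<longleftrightarrow> (\<forall>i<length v. v ! i \<in> {1..\<kappa> (y i)}) \<and>
     (\<Sum>i<length v. \<xi> (y i)) \<le> t \<and> t < (\<Sum>i<Suc (length v). \<xi> (y i))"

lemma measurable_alive_along [measurable]:
  "{y \<in> space (\<Pi>\<^sub>M n\<in>UNIV. MX). alive_along t y v} \<in> sets (\<Pi>\<^sub>M n\<in>UNIV. MX)"
proof -
  note [measurable] = measurable_lifetime measurable_offspring
  show ?thesis unfolding alive_along_def by measurable
qed

text \<open>Whether \<open>v\<close> is alive is decided by the types of \<open>v\<close> and its
  ancestors. These form the beginning of an infinite line of descent, whose law is that of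
  \<open>X\<close>.\<close>

lemma alive_cell_law:
  "emeasure M {\<omega> \<in> space M. cell_exists \<omega> v \<and> birth_time \<omega> v \<le> t \<and> t < death_time \<omega> v}
     = emeasure M {\<omega> \<in> space M. alive_along t (\<lambda>n. X n \<omega>) v}"
  "{\<omega> \<in> space M. cell_exists \<omega> v \<and> birth_time \<omega> v \<le> t \<and> t < death_time \<omega> v} \<in> sets M"
proof -
  let ?P = "\<Pi>\<^sub>M n\<in>UNIV. MX"
  let ?E = "{\<omega> \<in> space M. cell_exists \<omega> v \<and> birth_time \<omega> v \<le> t \<and> t < death_time \<omega> v}"
  have "emeasure M ?E = emeasure M {\<omega> \<in> space M. alive_along t (\<lambda>n. X n \<omega>) v} \<and> ?E \<in> sets M"
  proof (cases "\<forall>k\<in>set v. 1 \<le> k")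
    \<comment> \<open>A label with an entry 0 lies on no line of descent, but offspring are numbered
      from 1, so both events are empty.\<close>
    case False
    then obtain i where "i < length v" "\<not> 1 \<le> v ! i" by (metis in_set_conv_nth)
    then have "\<not> cell_exists \<omega> v" "\<not> alive_along t y v" for \<omega> y
      unfolding cell_exists_def alive_along_def by (meson atLeastAtMost_iff)+
    then show ?thesis by simp
  next
    case True
    \<comment> \<open>The model speaks of infinite lines; \<open>v\<close> is continued by ones, and
      any positive continuation would serve.\<close>
    define k where "k n = (if n < length v then v ! n else 1)" for n
    have k: "1 \<le> k n" for n using True by (auto simp: k_def)
    have desc: "descent k n = take n v" if "n \<le> length v" for n
      using that unfolding descent_def k_def by (intro nth_equalityI) auto
    have E: "?E = {\<omega> \<in> space M. alive_along t (\<lambda>n. Xc (descent k n) \<omega>) v}"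
      by (simp add: cell_exists_def birth_time_def death_time_def alive_along_def desc)
    have [measurable]: "Xc (descent k n) \<in> M \<rightarrow>\<^sub>M MX" for n
      using k by (intro measurable_Xc) (auto simp: descent_def)
    have [measurable]: "(\<lambda>\<omega> n. Xc (descent k n) \<omega>) \<in> M \<rightarrow>\<^sub>M ?P"
      by (intro measurable_abs_UNIV) measurable
    have [measurable]: "(\<lambda>\<omega> n. X n \<omega>) \<in> M \<rightarrow>\<^sub>M ?P"
      by (intro measurable_abs_UNIV measurable_X)
    have pre: "emeasure (distr M ?P (\<lambda>\<omega> n. Y n \<omega>)) {y \<in> space ?P. alive_along t y v}
        = emeasure M {\<omega> \<in> space M. alive_along t (\<lambda>n. Y n \<omega>) v}"
      and meas: "{\<omega> \<in> space M. alive_along t (\<lambda>n. Y n \<omega>) v} \<in> sets M"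
      if Y: "(\<lambda>\<omega> n. Y n \<omega>) \<in> M \<rightarrow>\<^sub>M ?P" for Y
    proof -
      have "(\<lambda>\<omega> n. Y n \<omega>) -` {y \<in> space ?P. alive_along t y v} \<inter> space M
        = {\<omega> \<in> space M. alive_along t (\<lambda>n. Y n \<omega>) v}"
        using measurable_space[OF Y] by auto
      then show "emeasure (distr M ?P (\<lambda>\<omega> n. Y n \<omega>)) {y \<in> space ?P. alive_along t y v}
        = emeasure M {\<omega> \<in> space M. alive_along t (\<lambda>n. Y n \<omega>) v}"
        "{\<omega> \<in> space M. alive_along t (\<lambda>n. Y n \<omega>) v} \<in> sets M"
        using emeasure_distr[OF Y measurable_alive_along[of t v]]
          measurable_sets[OF Y measurable_alive_along[of t v]] by simp_all
    qed
    have "emeasure M ?E = emeasure M {\<omega> \<in> space M. alive_along t (\<lambda>n. X n \<omega>) v}"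
      unfolding E by (subst (1 2) pre[symmetric]) (auto simp: descent_law[OF k])
    moreover have "?E \<in> sets M" unfolding E by (rule meas) measurable
    ultimately show ?thesis by blast
  qed
  then show "emeasure M ?E = emeasure M {\<omega> \<in> space M. alive_along t (\<lambda>n. X n \<omega>) v}" "?E \<in> sets M"
    by blast+
qed

text \<open>For a fixed sequence \<open>y\<close>, all cells of generation n live during the same
  time interval, so either all of them are alive at t or none; their number is the product of the
  first n offspring numbers.\<close>

lemma emeasure_alive_along:
  "emeasure (count_space UNIV) {v. alive_along t y v} =
     (\<Sum>n. ennreal (\<Prod>i<n. real (\<kappa> (y i))) *
        indicator {y. (\<Sum>i<n. \<xi> (y i)) \<le> t \<and> t < (\<Sum>i<Suc n. \<xi> (y i))} y)"
proof -
  let ?V = "\<lambda>n. {v. length v = n \<and> alive_along t y v}"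
  have "emeasure (count_space UNIV) {v. alive_along t y v} = emeasure (count_space UNIV) (\<Union>n. ?V n)"
    by (intro arg_cong[where f="emeasure _"]) auto
  also have "\<dots> = (\<Sum>n. emeasure (count_space UNIV) (?V n))"
    by (rule suminf_emeasure[symmetric]) (auto simp: disjoint_family_on_def)
  also have "(\<lambda>n. emeasure (count_space UNIV) (?V n)) = (\<lambda>n. ennreal (\<Prod>i<n. real (\<kappa> (y i))) *
      indicator {y. (\<Sum>i<n. \<xi> (y i)) \<le> t \<and> t < (\<Sum>i<Suc n. \<xi> (y i))} y)"
  proof (rule ext)
    fix n
    show "emeasure (count_space UNIV) (?V n) = ennreal (\<Prod>i<n. real (\<kappa> (y i))) *
      indicator {y. (\<Sum>i<n. \<xi> (y i)) \<le> t \<and> t < (\<Sum>i<Suc n. \<xi> (y i))} y"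
    proof (cases "(\<Sum>i<n. \<xi> (y i)) \<le> t \<and> t < (\<Sum>i<Suc n. \<xi> (y i))")
      case True
      then have "?V n = {v. length v = n \<and> (\<forall>i<length v. v ! i \<in> {1..\<kappa> (y i)})}"
        by (auto simp: alive_along_def)
      then show ?thesis
        using card_bounded_lists[of n "\<lambda>i. \<kappa> (y i)"] True
        by (simp add: emeasure_count_space_finite ennreal_of_nat_eq_real_of_nat)
    next
      case False
      then have V: "?V n = {}" by (auto simp: alive_along_def)
      show ?thesis unfolding V using False by auto
    qed
  qed
  finally show ?thesis .
qed

text \<open>Expectation and the countable sum over labels are exchanged, each event is replaced by
  the equally likely one along \<open>X\<close>, and the sum is taken back inside. Joint laws of
  different branches never enter.\<close>

lemma nn_integral_N:
  "(\<integral>\<^sup>+\<omega>. N t \<omega> \<partial>M) = (\<Sum>n. \<integral>\<^sup>+\<omega>. ennreal (\<Prod>i<n. real (\<kappa> (X i \<omega>))) *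
      indicator {y. (\<Sum>i<n. \<xi> (y i)) \<le> t \<and> t < (\<Sum>i<Suc n. \<xi> (y i))} (\<lambda>n. X n \<omega>) \<partial>M)"
proof -
  note [measurable] = measurable_lifetime measurable_offspring measurable_X
  let ?E = "\<lambda>v. {\<omega> \<in> space M. cell_exists \<omega> v \<and> birth_time \<omega> v \<le> t \<and> t < death_time \<omega> v}"
  let ?D = "\<lambda>v. {\<omega> \<in> space M. alive_along t (\<lambda>n. X n \<omega>) v}"
  have count: "emeasure (count_space UNIV) {v. R v \<omega>} = (\<integral>\<^sup>+v. indicator {\<omega> \<in> space M. R v \<omega>} \<omega> \<partial>count_space UNIV)"
    if "\<omega> \<in> space M" for R :: "nat list \<Rightarrow> 'w \<Rightarrow> bool" and \<omega>
  proof -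
    have "(\<integral>\<^sup>+v. indicator {\<omega> \<in> space M. R v \<omega>} \<omega> \<partial>count_space UNIV)
      = (\<integral>\<^sup>+v. indicator {v. R v \<omega>} v \<partial>count_space UNIV)"
      using that by (intro nn_integral_cong) (simp add: indicator_def)
    then show ?thesis by (simp only: nn_integral_indicator sets_count_space Pow_UNIV UNIV_I)
  qed
  have D: "?D v \<in> sets M" for v
    unfolding alive_along_def by measurable
  have "(\<integral>\<^sup>+\<omega>. N t \<omega> \<partial>M) = (\<integral>\<^sup>+\<omega>. \<integral>\<^sup>+v. indicator (?E v) \<omega> \<partial>count_space UNIV \<partial>M)"
    unfolding N_def by (intro nn_integral_cong count)
  also have "\<dots> = (\<integral>\<^sup>+v. \<integral>\<^sup>+\<omega>. indicator (?E v) \<omega> \<partial>M \<partial>count_space UNIV)"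
    using alive_cell_law(2) by (intro nn_integral_count_space_nn_integral) auto
  also have "\<dots> = (\<integral>\<^sup>+v. \<integral>\<^sup>+\<omega>. indicator (?D v) \<omega> \<partial>M \<partial>count_space UNIV)"
    using D by (simp add: nn_integral_indicator alive_cell_law)
  also have "\<dots> = (\<integral>\<^sup>+\<omega>. \<integral>\<^sup>+v. indicator (?D v) \<omega> \<partial>count_space UNIV \<partial>M)"
    using D by (intro nn_integral_count_space_nn_integral[symmetric]) auto
  also have "\<dots> = (\<integral>\<^sup>+\<omega>. emeasure (count_space UNIV) {v. alive_along t (\<lambda>n. X n \<omega>) v} \<partial>M)"
    by (intro nn_integral_cong count[symmetric])
  also have "\<dots> = (\<Sum>n. \<integral>\<^sup>+\<omega>. ennreal (\<Prod>i<n. real (\<kappa> (X i \<omega>))) *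
      indicator {y. (\<Sum>i<n. \<xi> (y i)) \<le> t \<and> t < (\<Sum>i<Suc n. \<xi> (y i))} (\<lambda>n. X n \<omega>) \<partial>M)"
    unfolding emeasure_alive_along
    by (intro nn_integral_suminf) measurable
  finally show ?thesis .
qed

end

section \<open>Conditioning on the initial cell, and regularity of f_{x,0}\<close>

lemma regular_cond_distr_disintegration:
  assumes cond: "regular_cond_distr M MZ Z MY Y K" and M: "prob_space M"
    and Z [measurable]: "Z \<in> M \<rightarrow>\<^sub>M MZ" and Y [measurable]: "Y \<in> M \<rightarrow>\<^sub>M MY"
    and B [measurable]: "B \<in> sets (MZ \<Otimes>\<^sub>M MY)"
  shows "emeasure M {\<omega> \<in> space M. (Z \<omega>, Y \<omega>) \<in> B} = (\<integral>\<^sup>+\<omega>. emeasure (K (Z \<omega>)) (Pair (Z \<omega>) -` B) \<partial>M)"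
    and "(\<lambda>z. emeasure (K z) (Pair z -` B)) \<in> borel_measurable MZ"
proof -
  interpret M: prob_space M by (rule M)
  have K: "K \<in> MZ \<rightarrow>\<^sub>M prob_algebra MY"
    and rect: "\<And>A C. A \<in> sets MZ \<Longrightarrow> C \<in> sets MY \<Longrightarrow> emeasure M {\<omega>\<in>space M. Z \<omega> \<in> A \<and> Y \<omega> \<in> C}
          = (\<integral>\<^sup>+z\<in>A. emeasure (K z) C \<partial>distr M MZ Z)"
    using cond unfolding regular_cond_distr_def by auto
  have Ks [measurable]: "K \<in> MZ \<rightarrow>\<^sub>M subprob_algebra MY" using K by (rule measurable_prob_algebraD)
  have setsK: "sets (K z) = sets MY" if "z \<in> space MZ" for z
    using measurable_space[OF K that] by (simp add: space_prob_algebra)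
  have spaceK: "space (K z) = space MY" if "z \<in> space MZ" for z
    using setsK[OF that] by (rule sets_eq_imp_space_eq)
  \<comment> \<open>The law of (Z, Y) built from the kernel. It agrees with the joint law on
    rectangles, which form an intersection-stable generator. General sets are required because the
    event on S_{n+1} couples \<open>X 0\<close> with the later lifetimes.\<close>
  define Q where "Q = distr M MZ Z \<bind> (\<lambda>z. distr (K z) (MZ \<Otimes>\<^sub>M MY) (Pair z))"
  have ne: "space (distr M MZ Z) \<noteq> {}"
    using M.not_empty measurable_space[OF Z] by auto
  have ker: "(\<lambda>z. distr (K z) (MZ \<Otimes>\<^sub>M MY) (Pair z)) \<in> distr M MZ Z \<rightarrow>\<^sub>M subprob_algebra (MZ \<Otimes>\<^sub>M MY)"
    by (intro measurable_distr2[where M=MY]) simp_all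
  have pre: "Pair z -` C \<inter> space (K z) = Pair z -` C" if "z \<in> space MZ" "C \<in> sets (MZ \<Otimes>\<^sub>M MY)" for z C
    using sets.sets_into_space[OF that(2)] spaceK[OF that(1)] by (auto simp: space_pair_measure)
  have emQ: "emeasure Q C = (\<integral>\<^sup>+z. emeasure (K z) (Pair z -` C) \<partial>distr M MZ Z)"
    if C: "C \<in> sets (MZ \<Otimes>\<^sub>M MY)" for C
    unfolding Q_def
  proof (subst emeasure_bind[OF ne ker C], intro nn_integral_cong)
    fix z assume "z \<in> space (distr M MZ Z)"
    then have z: "z \<in> space MZ" by simp
    have "Pair z \<in> K z \<rightarrow>\<^sub>M MZ \<Otimes>\<^sub>M MY"
      using measurable_Pair1'[OF z] by (simp cong: measurable_cong_sets add: setsK[OF z])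
    then show "emeasure (distr (K z) (MZ \<Otimes>\<^sub>M MY) (Pair z)) C = emeasure (K z) (Pair z -` C)"
      using C by (simp add: emeasure_distr pre[OF z C])
  qed
  have setsQ: "sets Q = sets (MZ \<Otimes>\<^sub>M MY)"
    unfolding Q_def by (rule sets_bind_measurable[OF ker ne])
  have "distr M (MZ \<Otimes>\<^sub>M MY) (\<lambda>\<omega>. (Z \<omega>, Y \<omega>)) = Q"
  proof (rule measure_eqI_generator_eq[OF Int_stable_pair_measure_generator pair_measure_closed])
    fix R assume "R \<in> {A \<times> C | A C. A \<in> sets MZ \<and> C \<in> sets MY}"
    then obtain A C where R: "R = A \<times> C" and [measurable]: "A \<in> sets MZ" "C \<in> sets MY" by auto
    have "emeasure (distr M (MZ \<Otimes>\<^sub>M MY) (\<lambda>\<omega>. (Z \<omega>, Y \<omega>))) R = emeasure M {\<omega>\<in>space M. Z \<omega> \<in> A \<and> Y \<omega> \<in> C}"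
      unfolding R by (subst emeasure_distr) (auto intro!: arg_cong[where f="emeasure M"])
    also have "\<dots> = (\<integral>\<^sup>+z\<in>A. emeasure (K z) C \<partial>distr M MZ Z)"
      by (rule rect) fact+
    also have "\<dots> = emeasure Q R"
      unfolding R by (subst emQ) (auto intro!: nn_integral_cong simp: indicator_def)
    finally show "emeasure (distr M (MZ \<Otimes>\<^sub>M MY) (\<lambda>\<omega>. (Z \<omega>, Y \<omega>))) R = emeasure Q R" .
  next
    show "range (\<lambda>_::nat. space MZ \<times> space MY) \<subseteq> {A \<times> C | A C. A \<in> sets MZ \<and> C \<in> sets MY}" by auto
    show "emeasure (distr M (MZ \<Otimes>\<^sub>M MY) (\<lambda>\<omega>. (Z \<omega>, Y \<omega>))) (space MZ \<times> space MY) \<noteq> \<infinity>"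
      using prob_space.emeasure_le_1[OF M.prob_space_distr[of "\<lambda>\<omega>. (Z \<omega>, Y \<omega>)" "MZ \<Otimes>\<^sub>M MY"]]
      by (auto simp: top_unique neq_top_trans[OF ennreal_one_neq_top])
  qed (auto simp: setsQ sets_pair_measure)
  then have "emeasure (distr M (MZ \<Otimes>\<^sub>M MY) (\<lambda>\<omega>. (Z \<omega>, Y \<omega>))) B = emeasure Q B" by simp
  moreover have "emeasure (distr M (MZ \<Otimes>\<^sub>M MY) (\<lambda>\<omega>. (Z \<omega>, Y \<omega>))) B = emeasure M {\<omega> \<in> space M. (Z \<omega>, Y \<omega>) \<in> B}"
    by (subst emeasure_distr) (auto intro!: arg_cong[where f="emeasure M"])
  moreover show meas [measurable]: "(\<lambda>z. emeasure (K z) (Pair z -` B)) \<in> borel_measurable MZ"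
  proof (rule emeasure_measurable_subprob_algebra2[OF _ Ks])
    have "(SIGMA z:space MZ. Pair z -` B) = B"
      using sets.sets_into_space[OF B] by (auto simp: space_pair_measure)
    then show "(SIGMA z:space MZ. Pair z -` B) \<in> sets (MZ \<Otimes>\<^sub>M MY)" by simp
  qed
  ultimately show "emeasure M {\<omega> \<in> space M. (Z \<omega>, Y \<omega>) \<in> B} = (\<integral>\<^sup>+\<omega>. emeasure (K (Z \<omega>)) (Pair (Z \<omega>) -` B) \<partial>M)"
    by (simp add: emQ nn_integral_distr)
qed

lemma measurable_lifetime_space_component:
  "(\<lambda>s. s j) \<in> borel_measurable lifetime_space"
proof -
  have "(\<lambda>s. s j) \<in> lifetime_space \<rightarrow>\<^sub>M restrict_space borel {0..}"
    unfolding lifetime_space_def by (rule measurable_component_singleton) simp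
  then show ?thesis by (simp add: measurable_restrict_space2_iff)
qed

text \<open>The series in \<open>f0\<close> is nondecreasing in t, so an infinite value would
  persist at all later times and make the Laplace integral infinite.\<close>

lemma f0_finite:
  fixes k1 \<nu> \<gamma> :: real
  assumes setsP: "sets P = sets lifetime_space" and k1: "1 < k1"
    and fin: "laplace (f0 k1 \<nu> P) \<gamma> < \<infinity>"
  shows "f0 k1 \<nu> P t < \<infinity>"
proof (rule ccontr)
  define H where "H t = (\<Sum>n. ennreal (k1 ^ n) * emeasure P {s \<in> space P. (\<Sum>j=1..n + 1. s j) \<le> t})" for t
  assume "\<not> f0 k1 \<nu> P t < \<infinity>"
  then have Ht: "H t = \<infinity>"
    unfolding f0_def H_def[symmetric] by (auto simp: ennreal_mult_eq_top_iff simp flip: less_top)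
  have [measurable]: "(\<lambda>s. s j) \<in> borel_measurable P" for j :: nat
    using measurable_lifetime_space_component by (simp add: setsP cong: measurable_cong_sets)
  have "H t \<le> H u" if "t \<le> u" for u
    unfolding H_def using that by (intro suminf_le mult_left_mono emeasure_mono) auto
  then have Hu: "H u = \<infinity>" if "t \<le> u" for u
    using that Ht by (metis infinity_ennreal_def top.extremum_unique)
  \<comment> \<open>The Laplace integral runs over nonnegative times only, so the window on which
    the integrand is infinite starts at max(0, t).\<close>
  define a where "a = max 0 t"
  have "\<infinity> = (\<integral>\<^sup>+u. \<infinity> * indicator {a..a+1} u \<partial>lborel)"
    by (subst nn_integral_cmult_indicator) (auto simp: ennreal_top_mult)
  also have "\<dots> \<le> laplace (f0 k1 \<nu> P) \<gamma>"
    unfolding laplace_def f0_def H_def[symmetric] using k1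
    by (intro nn_integral_mono) (auto simp: indicator_def a_def Hu ennreal_mult_top)
  finally show False using fin by (simp add: top_unique)
qed

text \<open>Multiplication by exp(nu t) leaves a nonnegative combination of distribution functions.
  This is the source of the monotonicity that inversion relies on, and measurability follows from
  it. Vanishing for t < 0 holds because \<open>lifetime_space\<close> carries nonnegative sequences
  only.\<close>

lemma f0_representation:
  fixes k1 \<nu> :: real
  assumes setsP: "sets P = sets lifetime_space" and P: "prob_space P" and k1: "1 < k1"
    and fin: "\<And>t. f0 k1 \<nu> P t < \<infinity>"
  defines "f \<equiv> \<lambda>t. enn2real (f0 k1 \<nu> P t)"
  shows "f0 k1 \<nu> P = (\<lambda>t. ennreal (f t))" and "\<And>t. 0 \<le> f t" and "\<And>t. t < 0 \<Longrightarrow> f t = 0"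
    and "mono (\<lambda>t. exp (\<nu> * t) * f t)" and "f \<in> borel_measurable borel"
proof -
  interpret P: prob_space P by (rule P)
  define H where "H t = (\<Sum>n. ennreal (k1 ^ n) * emeasure P {s \<in> space P. (\<Sum>j=1..n + 1. s j) \<le> t})" for t
  show eq: "f0 k1 \<nu> P = (\<lambda>t. ennreal (f t))"
    using fin by (simp add: f_def less_top fun_eq_iff)
  show nonneg: "\<And>t. 0 \<le> f t" by (simp add: f_def)
  have spaceP: "space P = (\<Pi>\<^sub>E n\<in>UNIV. {0..})"
    using sets_eq_imp_space_eq[OF setsP] by (simp add: lifetime_space_def space_PiM space_restrict_space)
  show "f t = 0" if "t < 0" for t
  proof -
    have "\<not> (\<Sum>j=1..n + 1. s j) \<le> t" if "s \<in> space P" for s n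
    proof -
      have "0 \<le> (\<Sum>j=1..n + 1. s j)" using that by (intro sum_nonneg) (auto simp: spaceP)
      then show ?thesis using \<open>t < 0\<close> by linarith
    qed
    then have "{s \<in> space P. (\<Sum>j=1..n + 1. s j) \<le> t} = {}" for n by blast
    then show ?thesis
      by (simp only: f_def f0_def emeasure_empty mult_zero_right suminf_zero enn2real_0)
  qed
  have H: "ennreal ((k1 - 1) * exp (- \<nu> * t)) * H t = ennreal (f t)" for t
    using fun_cong[OF eq, of t] by (simp add: f0_def H_def)
  have Hf: "ennreal (exp (\<nu> * t) * f t) = ennreal (k1 - 1) * H t" for t
  proof -
    have "ennreal (exp (\<nu> * t) * f t) = ennreal (exp (\<nu> * t)) * ennreal ((k1 - 1) * exp (- \<nu> * t)) * H t"
      unfolding mult.assoc H by (simp add: ennreal_mult nonneg)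
    also have "ennreal (exp (\<nu> * t)) * ennreal ((k1 - 1) * exp (- \<nu> * t)) = ennreal (k1 - 1)"
      using k1 by (subst ennreal_mult[symmetric]) (auto simp: mult.left_commute simp flip: exp_add)
    finally show ?thesis .
  qed
  have [measurable]: "(\<lambda>s. s j) \<in> borel_measurable P" for j :: nat
    using measurable_lifetime_space_component by (simp add: setsP cong: measurable_cong_sets)
  show mono: "mono (\<lambda>t. exp (\<nu> * t) * f t)"
  proof (rule monoI)
    fix t u :: real assume "t \<le> u"
    then have "H t \<le> H u"
      unfolding H_def by (intro suminf_le mult_left_mono emeasure_mono) auto
    then have "ennreal (exp (\<nu> * t) * f t) \<le> ennreal (exp (\<nu> * u) * f u)"
      unfolding Hf by (intro mult_left_mono) auto
    then show "exp (\<nu> * t) * f t \<le> exp (\<nu> * u) * f u"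
      using nonneg by (simp add: ennreal_le_iff)
  qed
  have "(\<lambda>t. exp (- \<nu> * t) * (exp (\<nu> * t) * f t)) \<in> borel_measurable borel"
    using borel_measurable_mono[OF mono] by measurable
  also have "(\<lambda>t. exp (- \<nu> * t) * (exp (\<nu> * t) * f t)) = f"
    by (simp add: fun_eq_iff flip: mult.assoc exp_add)
  finally show "f \<in> borel_measurable borel" .
qed

section \<open>The mean number of cells as a series over generations\<close>

context branching_model
begin

text \<open>This is P(S_{n-1} \<le> t), with the empty sum at n = 0 standing for the birth of the
  initial cell at time 0.\<close>

definition birth_prob :: "real \<Rightarrow> nat \<Rightarrow> real" where
  "birth_prob t n = prob {\<omega> \<in> space M. (\<Sum>i<n. \<xi> (X i \<omega>)) \<le> t}"

text \<open>Independence from the lifetimes splits off the offspring product, whose mean is the n-th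
  power because its factors are i.i.d. Lifetimes being nonnegative, {S_n \<le> t} lies in {S_{n-1}
  \<le> t}, so the remaining probability is a difference.\<close>

lemma nn_integral_generation:
  assumes kappa_indep: "indep_vars (\<lambda>i. count_space UNIV) (\<lambda>i \<omega>. \<kappa> (X i \<omega>)) UNIV"
    and kappa_ident: "\<And>i. distr M (count_space UNIV) (\<lambda>\<omega>. \<kappa> (X i \<omega>))
                         = distr M (count_space UNIV) (\<lambda>\<omega>. \<kappa> (X 1 \<omega>))"
    and kappa_integrable: "integrable M (\<lambda>\<omega>. real (\<kappa> (X 1 \<omega>)))"
    and kappa_xi_indep: "indep_var
          (\<Pi>\<^sub>M i\<in>UNIV. borel) (\<lambda>\<omega> i. real (\<kappa> (X i \<omega>)))
          (\<Pi>\<^sub>M i\<in>UNIV. borel) (\<lambda>\<omega> i. \<xi> (X i \<omega>))"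
  shows "(\<integral>\<^sup>+\<omega>. ennreal (\<Prod>i<n. real (\<kappa> (X i \<omega>))) *
      indicator {y. (\<Sum>i<n. \<xi> (y i)) \<le> t \<and> t < (\<Sum>i<Suc n. \<xi> (y i))} (\<lambda>n. X n \<omega>) \<partial>M)
    = ennreal (\<kappa>\<^sub>1 ^ n * (birth_prob t n - birth_prob t (Suc n)))"
proof -
  note [measurable] = measurable_lifetime measurable_offspring measurable_X
  let ?g = "indicator {s. (\<Sum>i<n. s i) \<le> t \<and> t < (\<Sum>i<Suc n. s i)} :: (nat \<Rightarrow> real) \<Rightarrow> ennreal"
  have g [measurable]: "?g \<in> borel_measurable (\<Pi>\<^sub>M i\<in>UNIV. borel)"
  proof -
    have "{s \<in> space (\<Pi>\<^sub>M i\<in>UNIV. borel). (\<Sum>i<n. s i) \<le> t \<and> t < (\<Sum>i<Suc n. s i)} \<in> sets (\<Pi>\<^sub>M i\<in>UNIV. (borel :: real measure))"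
      by measurable
    then show ?thesis by (simp add: space_PiM)
  qed
  have k1: "(\<integral>\<^sup>+\<omega>. ennreal (real (\<kappa> (X i \<omega>))) \<partial>M) = ennreal \<kappa>\<^sub>1" for i
  proof -
    have "(\<integral>\<^sup>+\<omega>. ennreal (real (\<kappa> (X j \<omega>))) \<partial>M)
      = (\<integral>\<^sup>+k. ennreal (real k) \<partial>distr M (count_space UNIV) (\<lambda>\<omega>. \<kappa> (X j \<omega>)))" for j
      by (subst nn_integral_distr) auto
    then have "(\<integral>\<^sup>+\<omega>. ennreal (real (\<kappa> (X i \<omega>))) \<partial>M) = (\<integral>\<^sup>+\<omega>. ennreal (real (\<kappa> (X 1 \<omega>))) \<partial>M)"
      using kappa_ident[of i] by simp
    also have "\<dots> = ennreal \<kappa>\<^sub>1"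
      unfolding \<kappa>\<^sub>1_def using kappa_integrable by (intro nn_integral_eq_integral) auto
    finally show ?thesis .
  qed
  have "(\<integral>\<^sup>+\<omega>. ennreal (\<Prod>i<n. real (\<kappa> (X i \<omega>))) *
      indicator {y. (\<Sum>i<n. \<xi> (y i)) \<le> t \<and> t < (\<Sum>i<Suc n. \<xi> (y i))} (\<lambda>n. X n \<omega>) \<partial>M)
    = (\<integral>\<^sup>+\<omega>. ennreal (\<Prod>i<n. real (\<kappa> (X i \<omega>))) * ?g (\<lambda>i. \<xi> (X i \<omega>)) \<partial>M)"
    by (simp add: indicator_def)
  also have "\<dots> = (\<integral>\<^sup>+\<omega>. ennreal (\<Prod>i<n. real (\<kappa> (X i \<omega>))) \<partial>M) * (\<integral>\<^sup>+\<omega>. ?g (\<lambda>i. \<xi> (X i \<omega>)) \<partial>M)"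
    by (rule indep_var_nn_integral_mult[OF kappa_xi_indep, of "\<lambda>s. ennreal (\<Prod>i<n. s i)" ?g]) measurable
  also have "(\<integral>\<^sup>+\<omega>. ennreal (\<Prod>i<n. real (\<kappa> (X i \<omega>))) \<partial>M) = (\<integral>\<^sup>+\<omega>. (\<Prod>i<n. ennreal (real (\<kappa> (X i \<omega>)))) \<partial>M)"
    by (simp add: prod_ennreal)
  also have "\<dots> = (\<Prod>i<n. \<integral>\<^sup>+\<omega>. ennreal (real (\<kappa> (X i \<omega>))) \<partial>M)"
    by (intro indep_vars_nn_integral indep_vars_compose2[OF indep_vars_subset[OF kappa_indep]]) auto
  also have "\<dots> = ennreal (\<kappa>\<^sub>1 ^ n)"
    unfolding k1 by (simp add: ennreal_power \<kappa>\<^sub>1_def)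
  also have "(\<integral>\<^sup>+\<omega>. ?g (\<lambda>i. \<xi> (X i \<omega>)) \<partial>M) = ennreal (birth_prob t n - birth_prob t (Suc n))"
  proof -
    let ?A = "\<lambda>n. {\<omega> \<in> space M. (\<Sum>i<n. \<xi> (X i \<omega>)) \<le> t}"
    have "\<And>\<omega>. \<omega> \<in> space M \<Longrightarrow> 0 \<le> \<xi> (X n \<omega>)"
      by (intro lifetime_nonneg measurable_space[OF measurable_X])
    then have sub: "?A (Suc n) \<subseteq> ?A n" by (force intro: order_trans[rotated])
    have "(\<integral>\<^sup>+\<omega>. ?g (\<lambda>i. \<xi> (X i \<omega>)) \<partial>M) = (\<integral>\<^sup>+\<omega>. indicator (?A n - ?A (Suc n)) \<omega> \<partial>M)"
      by (intro nn_integral_cong) (auto simp: indicator_def)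
    also have "\<dots> = emeasure M (?A n - ?A (Suc n))"
      by (rule nn_integral_indicator) measurable
    also have "\<dots> = ennreal (prob (?A n) - prob (?A (Suc n)))"
      using sub by (subst emeasure_eq_measure, subst finite_measure_Diff) auto
    finally show ?thesis by (simp add: birth_prob_def)
  qed
  finally show ?thesis
    by (simp add: ennreal_mult' \<kappa>\<^sub>1_def)
qed

lemma kappa1_ge_2:
  assumes "integrable M (\<lambda>\<omega>. real (\<kappa> (X 1 \<omega>)))"
  shows "2 \<le> \<kappa>\<^sub>1"
proof -
  have "2 \<le> real (\<kappa> (X 1 \<omega>))" if "\<omega> \<in> space M" for \<omega>
    using offspring_ge_2[OF measurable_space[OF measurable_X that]] by (metis of_nat_le_iff of_nat_numeral)
  then show ?thesis unfolding \<kappa>\<^sub>1_def by (intro integral_ge_const assms) auto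
qed

text \<open>Summation by parts: P(S_{n+1} \<le> t) collects the weight k^(n+2) - k^(n+1) = k (k - 1)
  k^n, the origin of the extra factor k in the asymptotics. The indices 0 and 1 leave the terms 1
  and (k - 1) P(S_0 \<le> t).\<close>

lemma expectation_N:
  assumes gen: "\<And>n. (\<integral>\<^sup>+\<omega>. ennreal (\<Prod>i<n. real (\<kappa> (X i \<omega>))) *
      indicator {y. (\<Sum>i<n. \<xi> (y i)) \<le> t \<and> t < (\<Sum>i<Suc n. \<xi> (y i))} (\<lambda>n. X n \<omega>) \<partial>M)
    = ennreal (k ^ n * (birth_prob t n - birth_prob t (Suc n)))"
    and k: "0 \<le> k" and t: "0 \<le> t"
    and sums: "(\<lambda>n. k ^ n * birth_prob t (n + 2)) sums q"
  shows "(\<integral>\<^sup>+\<omega>. N t \<omega> \<partial>M) = ennreal (1 + (k - 1) * birth_prob t 1 + k * (k - 1) * q)"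
proof -
  note [measurable] = measurable_lifetime measurable_X
  have p0: "birth_prob t 0 = 1" using t by (simp add: birth_prob_def prob_space)
  have dec: "birth_prob t (Suc n) \<le> birth_prob t n" for n
  proof -
    have "\<And>\<omega>. \<omega> \<in> space M \<Longrightarrow> 0 \<le> \<xi> (X n \<omega>)"
      by (intro lifetime_nonneg measurable_space[OF measurable_X])
    then show ?thesis unfolding birth_prob_def
      by (intro finite_measure_mono) (force intro: order_trans[rotated])+
  qed
  \<comment> \<open>Convergence is carried back from the twice shifted series to the unshifted ones,
    so that their difference can be formed in the reals.\<close>
  have s1: "(\<lambda>n. k ^ n * birth_prob t (Suc n)) sums (birth_prob t 1 + k * q)"
    using sums_Suc[of "\<lambda>n. k ^ n * birth_prob t (Suc n)" "k * q"] sums_mult[OF sums, of k]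
    by (simp add: mult.assoc add.commute)
  have s0: "(\<lambda>n. k ^ n * birth_prob t n) sums (1 + k * (birth_prob t 1 + k * q))"
    using sums_Suc[of "\<lambda>n. k ^ n * birth_prob t n" "k * (birth_prob t 1 + k * q)"] sums_mult[OF s1, of k] p0
    by (simp add: mult.assoc add.commute)
  have s: "(\<lambda>n. k ^ n * (birth_prob t n - birth_prob t (Suc n))) sums
     (1 + k * (birth_prob t 1 + k * q) - (birth_prob t 1 + k * q))"
    using sums_diff[OF s0 s1] by (simp add: algebra_simps)
  have "(\<Sum>n. ennreal (k ^ n * (birth_prob t n - birth_prob t (Suc n))))
     = ennreal (1 + k * (birth_prob t 1 + k * q) - (birth_prob t 1 + k * q))"
    using k dec by (subst suminf_ennreal2) (simp_all add: sums_summable[OF s] sums_unique[OF s, symmetric])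
  then show ?thesis unfolding nn_integral_N gen by (simp add: algebra_simps)
qed

text \<open>S_{n+1} has n + 2 summands. The first is a function of \<open>X 0\<close> and moves to
  the right-hand side of the inequality; the others are evaluated under the kernel at
  \<open>X 0\<close>.\<close>

lemma birth_prob_disintegration:
  assumes cond: "regular_cond_distr M MX (X 0) lifetime_space (\<lambda>\<omega> n. \<xi> (X n \<omega>)) K"
  shows "ennreal (birth_prob t (n + 2)) =
      (\<integral>\<^sup>+\<omega>. emeasure (K (X 0 \<omega>)) {s \<in> space (K (X 0 \<omega>)). (\<Sum>j=1..n + 1. s j) \<le> t - \<xi> (X 0 \<omega>)} \<partial>M)"
    and "(\<lambda>\<omega>. emeasure (K (X 0 \<omega>)) {s \<in> space (K (X 0 \<omega>)). (\<Sum>j=1..n + 1. s j) \<le> t - \<xi> (X 0 \<omega>)})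
       \<in> borel_measurable M"
proof -
  note [measurable] = measurable_lifetime measurable_X
  note [measurable] = measurable_lifetime_space_component
  have Y: "(\<lambda>\<omega> n. \<xi> (X n \<omega>)) \<in> M \<rightarrow>\<^sub>M lifetime_space"
    unfolding lifetime_space_def
    by (intro measurable_abs_UNIV measurable_restrict_space2)
       (auto intro!: lifetime_nonneg measurable_space[OF measurable_X])
  define B where "B = {z \<in> space (MX \<Otimes>\<^sub>M lifetime_space). (\<Sum>j=1..n + 1. snd z j) \<le> t - \<xi> (fst z)}"
  have B: "B \<in> sets (MX \<Otimes>\<^sub>M lifetime_space)"
    unfolding B_def by measurable
  have K: "K \<in> MX \<rightarrow>\<^sub>M prob_algebra lifetime_space"
    using cond unfolding regular_cond_distr_def by auto
  have sec: "Pair x -` B = {s \<in> space (K x). (\<Sum>j=1..n + 1. s j) \<le> t - \<xi> x}" if "x \<in> space MX" for x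
  proof -
    have "space (K x) = space lifetime_space"
      using measurable_space[OF K that] by (auto simp: space_prob_algebra dest: sets_eq_imp_space_eq)
    then show ?thesis using that by (auto simp: B_def space_pair_measure)
  qed
  have shift: "(\<Sum>i<n + 2. a i) = a 0 + (\<Sum>j=1..n + 1. a j)" for a :: "nat \<Rightarrow> real"
    by (induction n) (auto simp: numeral_2_eq_2)
  have "{\<omega> \<in> space M. (\<Sum>i<n + 2. \<xi> (X i \<omega>)) \<le> t} = {\<omega> \<in> space M. (X 0 \<omega>, \<lambda>n. \<xi> (X n \<omega>)) \<in> B}"
    using measurable_space[OF Y] measurable_space[OF measurable_X, of _ 0]
    unfolding shift B_def by (auto simp: space_pair_measure)
  then have "ennreal (birth_prob t (n + 2)) = emeasure M {\<omega> \<in> space M. (X 0 \<omega>, \<lambda>n. \<xi> (X n \<omega>)) \<in> B}"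
    unfolding birth_prob_def by (simp add: emeasure_eq_measure)
  also have "\<dots> = (\<integral>\<^sup>+\<omega>. emeasure (K (X 0 \<omega>)) (Pair (X 0 \<omega>) -` B) \<partial>M)"
    by (rule regular_cond_distr_disintegration(1)[OF cond prob_space_axioms measurable_X Y B])
  also have "\<dots> = (\<integral>\<^sup>+\<omega>. emeasure (K (X 0 \<omega>)) {s \<in> space (K (X 0 \<omega>)). (\<Sum>j=1..n + 1. s j) \<le> t - \<xi> (X 0 \<omega>)} \<partial>M)"
    by (intro nn_integral_cong) (simp add: sec measurable_space[OF measurable_X])
  finally show "ennreal (birth_prob t (n + 2)) =
      (\<integral>\<^sup>+\<omega>. emeasure (K (X 0 \<omega>)) {s \<in> space (K (X 0 \<omega>)). (\<Sum>j=1..n + 1. s j) \<le> t - \<xi> (X 0 \<omega>)} \<partial>M)" .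
  have "(\<lambda>\<omega>. emeasure (K (X 0 \<omega>)) (Pair (X 0 \<omega>) -` B)) \<in> borel_measurable M"
    by (rule measurable_compose[OF measurable_X regular_cond_distr_disintegration(2)[OF cond prob_space_axioms measurable_X Y B]])
  then show "(\<lambda>\<omega>. emeasure (K (X 0 \<omega>)) {s \<in> space (K (X 0 \<omega>)). (\<Sum>j=1..n + 1. s j) \<le> t - \<xi> (X 0 \<omega>)})
       \<in> borel_measurable M"
    by (rule measurable_cong[THEN iffD1, rotated]) (simp add: sec measurable_space[OF measurable_X])
qed

text \<open>With u = t - \<xi>(X_0), the factor exp(nu u) cancels the exp(-nu u) built into
  \<open>f0\<close>. The identity lives in [0,\<infinity>], so convergence of the series can be
  deduced from finiteness of the right-hand side.\<close>

lemma suminf_birth_prob: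
  fixes k :: real
  assumes cond: "regular_cond_distr M MX (X 0) lifetime_space (\<lambda>\<omega> n. \<xi> (X n \<omega>)) K" and k: "1 \<le> k"
  shows "ennreal (k - 1) * (\<Sum>n. ennreal (k ^ n * birth_prob t (n + 2)))
    = (\<integral>\<^sup>+\<omega>. ennreal (exp (\<nu> * (t - \<xi> (X 0 \<omega>)))) * f0 k \<nu> (K (X 0 \<omega>)) (t - \<xi> (X 0 \<omega>)) \<partial>M)"
proof -
  let ?E = "\<lambda>n \<omega>. emeasure (K (X 0 \<omega>)) {s \<in> space (K (X 0 \<omega>)). (\<Sum>j=1..n + 1. s j) \<le> t - \<xi> (X 0 \<omega>)}"
  have m [measurable]: "?E n \<in> borel_measurable M" for n
    by (rule birth_prob_disintegration(2)[OF cond])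
  have "ennreal (k ^ n * birth_prob t (n + 2)) = (\<integral>\<^sup>+\<omega>. ennreal (k ^ n) * ?E n \<omega> \<partial>M)" for n
  proof -
    have "ennreal (k ^ n * birth_prob t (n + 2)) = ennreal (k ^ n) * ennreal (birth_prob t (n + 2))"
      using k by (intro ennreal_mult) (auto simp: birth_prob_def)
    then show ?thesis
      unfolding birth_prob_disintegration(1)[OF cond] nn_integral_cmult[OF m] .
  qed
  then have "ennreal (k - 1) * (\<Sum>n. ennreal (k ^ n * birth_prob t (n + 2)))
    = ennreal (k - 1) * (\<Sum>n. \<integral>\<^sup>+\<omega>. ennreal (k ^ n) * ?E n \<omega> \<partial>M)"
    by (simp only:)
  also have "\<dots> = (\<integral>\<^sup>+\<omega>. ennreal (k - 1) * (\<Sum>n. ennreal (k ^ n) * ?E n \<omega>) \<partial>M)"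
    by (subst nn_integral_suminf[symmetric], measurable) (rule nn_integral_cmult[symmetric], measurable)
  also have "\<dots> = (\<integral>\<^sup>+\<omega>. ennreal (exp (\<nu> * (t - \<xi> (X 0 \<omega>)))) * f0 k \<nu> (K (X 0 \<omega>)) (t - \<xi> (X 0 \<omega>)) \<partial>M)"
  proof (intro nn_integral_cong)
    fix \<omega>
    have "ennreal (exp (\<nu> * u)) * ennreal ((k - 1) * exp (- \<nu> * u)) = ennreal (k - 1)" for u
      using k by (subst ennreal_mult[symmetric]) (auto simp: mult.left_commute simp flip: exp_add)
    then show "ennreal (k - 1) * (\<Sum>n. ennreal (k ^ n) * ?E n \<omega>) = ennreal (exp (\<nu> * (t - \<xi> (X 0 \<omega>)))) * f0 k \<nu> (K (X 0 \<omega>)) (t - \<xi> (X 0 \<omega>))"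
      unfolding f0_def mult.assoc[symmetric] by simp
  qed
  finally show ?thesis .
qed

end

section \<open>Asymptotics of the mean number of cells\<close>

theorem proposition3p8:
  fixes M :: "'w measure" and MX :: "'x measure"
    and \<xi> :: "'x \<Rightarrow> real" and \<kappa> :: "'x \<Rightarrow> nat"
    and X :: "nat \<Rightarrow> 'w \<Rightarrow> 'x" and Xc :: "nat list \<Rightarrow> 'w \<Rightarrow> 'x"
    and K :: "'x \<Rightarrow> (nat \<Rightarrow> real) measure"
    and F :: "'x \<Rightarrow> complex \<Rightarrow> complex" and C\<^sub>0 :: "'x \<Rightarrow> real"
    and \<nu> \<delta> \<epsilon> \<kappa>\<^sub>1 :: real
  assumes model: "branching_model M MX \<xi> \<kappa> X Xc"
    and kappa1: "\<kappa>\<^sub>1 = branching_model.\<kappa>\<^sub>1 M \<kappa> X"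
    and stationary: "branching_model.stationary_X M MX X"
    and kappa_indep: "prob_space.indep_vars M (\<lambda>i. count_space UNIV) (\<lambda>i \<omega>. \<kappa> (X i \<omega>)) UNIV"
    and kappa_ident: "\<And>i. distr M (count_space UNIV) (\<lambda>\<omega>. \<kappa> (X i \<omega>))
                         = distr M (count_space UNIV) (\<lambda>\<omega>. \<kappa> (X 1 \<omega>))"
    and kappa_integrable: "integrable M (\<lambda>\<omega>. real (\<kappa> (X 1 \<omega>)))"
    and kappa_xi_indep: "prob_space.indep_var M
          (\<Pi>\<^sub>M i\<in>UNIV. borel) (\<lambda>\<omega> i. real (\<kappa> (X i \<omega>)))
          (\<Pi>\<^sub>M i\<in>UNIV. borel) (\<lambda>\<omega> i. \<xi> (X i \<omega>))"
    and nu: "branching_model.malthus M \<xi> \<kappa> X = ereal \<nu>"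
    and cond_law: "regular_cond_distr M MX (X 0) lifetime_space (\<lambda>\<omega> n. \<xi> (X n \<omega>)) K"
    and nu_cond: "\<And>x. x \<in> space MX \<Longrightarrow> ereal \<nu> = cond_malthus \<kappa>\<^sub>1 (K x)"
    and delta: "0 < \<delta>" "\<delta> < \<nu>" and eps: "0 < \<epsilon>"
    and analytic: "\<And>x. x \<in> space MX \<Longrightarrow>
          analytic_extension (laplace (f0 \<kappa>\<^sub>1 \<nu> (K x))) \<delta> \<epsilon> (F x) (C\<^sub>0 x)"
    and C0_finite: "integrable M (\<lambda>\<omega>. exp (- \<nu> * \<xi> (X 0 \<omega>)) * C\<^sub>0 (X 0 \<omega>))"
    and Psi0_finite: "integrable M (\<lambda>\<omega>. exp (- (\<nu> - \<delta>) * \<xi> (X 0 \<omega>)) * \<Psi>\<^sub>0 \<delta> (F (X 0 \<omega>)))"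
  shows "(\<forall>t\<ge>0. (\<integral>\<^sup>+\<omega>. branching_model.N \<xi> \<kappa> Xc t \<omega> \<partial>M) < \<infinity>) \<and>
    (\<exists>\<epsilon>\<^sub>1>0. \<exists>r :: real \<Rightarrow> real. r \<in> O[at_top](\<lambda>t. exp (- \<epsilon>\<^sub>1 * t)) \<and>
       (\<forall>t\<ge>0. enn2real (\<integral>\<^sup>+\<omega>. branching_model.N \<xi> \<kappa> Xc t \<omega> \<partial>M) =
          exp (\<nu> * t) * \<kappa>\<^sub>1 * (LINT \<omega>|M. exp (- \<nu> * \<xi> (X 0 \<omega>)) * C\<^sub>0 (X 0 \<omega>)) * (1 + r t)))"
proof -
  interpret branching_model M MX \<xi> \<kappa> X Xc by (rule model)
  have k2: "2 \<le> \<kappa>\<^sub>1" unfolding kappa1 by (rule kappa1_ge_2[OF kappa_integrable])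
  have nu_pos: "0 < \<nu>" using delta by simp
  define A where "A = (LINT \<omega>|M. exp (- \<nu> * \<xi> (X 0 \<omega>)) * C\<^sub>0 (X 0 \<omega>))"
  define W where "W = (LINT \<omega>|M. exp (- (\<nu> - \<delta>) * \<xi> (X 0 \<omega>)) * \<Psi>\<^sub>0 \<delta> (F (X 0 \<omega>)))"
  have K: "K \<in> MX \<rightarrow>\<^sub>M prob_algebra lifetime_space"
    using cond_law unfolding regular_cond_distr_def by auto
  define f where "f x t = enn2real (f0 \<kappa>\<^sub>1 \<nu> (K x) t)" for x t
  have fx: "f0 \<kappa>\<^sub>1 \<nu> (K x) = (\<lambda>t. ennreal (f x t))" "0 \<le> f x t" "0 < C\<^sub>0 x"
    "\<bar>f x t - C\<^sub>0 x\<bar> \<le> exp (- \<delta> * t) * \<Psi>\<^sub>0 \<delta> (F x) / (2 * pi)" if x: "x \<in> space MX" for x t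
  proof -
    have Kx: "sets (K x) = sets lifetime_space" "prob_space (K x)"
      using measurable_space[OF K x] by (auto simp: space_prob_algebra)
    have k: "1 < \<kappa>\<^sub>1" using k2 by simp
    \<comment> \<open>Finiteness of the transform at a single argument suffices for
      \<open>f0_finite\<close>; 1 is an arbitrary positive choice.\<close>
    have "laplace (f0 \<kappa>\<^sub>1 \<nu> (K x)) 1 < \<infinity>"
      using analytic[OF x] unfolding analytic_extension_def by simp
    note fin = f0_finite[OF Kx(1) k this]
    note rep = f0_representation[OF Kx k fin, folded f_def]
    show "f0 \<kappa>\<^sub>1 \<nu> (K x) = (\<lambda>t. ennreal (f x t))" "0 \<le> f x t" by (fact rep)+
    note lap = laplace_asymptotics[of "f x" \<nu> \<delta> \<epsilon> "F x" "C\<^sub>0 x", OF rep(2) rep(3) rep(5) rep(4)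
      less_imp_le[OF nu_pos] delta(1) eps analytic[OF x, unfolded rep(1)]]
    show "0 < C\<^sub>0 x" by (rule lap(1))
    show "\<bar>f x t - C\<^sub>0 x\<bar> \<le> exp (- \<delta> * t) * \<Psi>\<^sub>0 \<delta> (F x) / (2 * pi)" by (rule lap(2))
  qed
  have X0: "X 0 \<omega> \<in> space MX" if "\<omega> \<in> space M" for \<omega>
    by (rule measurable_space[OF measurable_X that])
  have Apos: "0 < A"
  proof -
    have "A \<noteq> 0"
    proof
      assume "A = 0"
      then have "AE \<omega> in M. exp (- \<nu> * \<xi> (X 0 \<omega>)) * C\<^sub>0 (X 0 \<omega>) = 0"
        unfolding A_def using fx(3) X0
        by (subst (asm) integral_nonneg_eq_0_iff_AE[OF C0_finite]) (auto intro!: AE_I2 less_imp_le)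
      then have "AE \<omega> in M. False"
        by (rule AE_mp) (use fx(3) X0 in \<open>force intro!: AE_I2\<close>)
      then show False by simp
    qed
    moreover have "0 \<le> A"
      unfolding A_def using fx(3) X0 by (intro integral_nonneg_AE AE_I2) (auto intro!: less_imp_le)
    ultimately show ?thesis by simp
  qed
  have main: "\<exists>q. (\<integral>\<^sup>+\<omega>. N t \<omega> \<partial>M) = ennreal (1 + (\<kappa>\<^sub>1 - 1) * birth_prob t 1 + \<kappa>\<^sub>1 * q) \<and> 0 \<le> q \<and>
      \<bar>q - exp (\<nu> * t) * A\<bar> \<le> exp ((\<nu> - \<delta>) * t) * W" if t: "0 \<le> t" for t
  proof -
    \<comment> \<open>The integrand, its leading part and the error bound. With u = t - \<xi>(X_0),
      the product exp(nu u) exp(-delta u) splits into exp((nu - delta) t) and exp(-(nu - delta)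
      \<xi>(X_0)), the weight in the integrability assumption on \<Psi>.\<close>
    let ?Z = "\<lambda>\<omega>. exp (\<nu> * (t - \<xi> (X 0 \<omega>))) * f (X 0 \<omega>) (t - \<xi> (X 0 \<omega>))"
    let ?U = "\<lambda>\<omega>. exp (\<nu> * t) * (exp (- \<nu> * \<xi> (X 0 \<omega>)) * C\<^sub>0 (X 0 \<omega>))"
    let ?V = "\<lambda>\<omega>. exp ((\<nu> - \<delta>) * t) * (exp (- (\<nu> - \<delta>) * \<xi> (X 0 \<omega>)) * \<Psi>\<^sub>0 \<delta> (F (X 0 \<omega>)))"
    have Z0: "0 \<le> ?Z \<omega>" and ZU: "\<bar>?Z \<omega> - ?U \<omega>\<bar> \<le> ?V \<omega>" if w: "\<omega> \<in> space M" for \<omega>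
    proof -
      let ?u = "t - \<xi> (X 0 \<omega>)"
      show "0 \<le> ?Z \<omega>" using fx(2)[OF X0[OF w]] by simp
      have U: "?U \<omega> = exp (\<nu> * ?u) * C\<^sub>0 (X 0 \<omega>)"
        by (simp add: algebra_simps flip: exp_add)
      have Psi: "0 \<le> \<Psi>\<^sub>0 \<delta> (F (X 0 \<omega>))" unfolding \<Psi>\<^sub>0_def by (intro integral_nonneg_AE) simp
      \<comment> \<open>The factor 1 / (2 pi) from the inversion formula is below 1 and is
        dropped.\<close>
      have "1 * 1 \<le> 2 * pi" using pi_ge_two by (intro mult_mono) auto
      then have "exp (- \<delta> * ?u) * \<Psi>\<^sub>0 \<delta> (F (X 0 \<omega>)) / (2 * pi) \<le> exp (- \<delta> * ?u) * \<Psi>\<^sub>0 \<delta> (F (X 0 \<omega>)) / 1"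
        using Psi by (intro divide_left_mono) auto
      with fx(4)[OF X0[OF w], of ?u] have "\<bar>f (X 0 \<omega>) ?u - C\<^sub>0 (X 0 \<omega>)\<bar> \<le> exp (- \<delta> * ?u) * \<Psi>\<^sub>0 \<delta> (F (X 0 \<omega>))"
        by simp
      then have "exp (\<nu> * ?u) * \<bar>f (X 0 \<omega>) ?u - C\<^sub>0 (X 0 \<omega>)\<bar> \<le> exp (\<nu> * ?u) * (exp (- \<delta> * ?u) * \<Psi>\<^sub>0 \<delta> (F (X 0 \<omega>)))"
        by (intro mult_left_mono) auto
      also have "\<dots> = ?V \<omega>"
        by (simp add: algebra_simps flip: exp_add)
      also have "exp (\<nu> * ?u) * \<bar>f (X 0 \<omega>) ?u - C\<^sub>0 (X 0 \<omega>)\<bar> = \<bar>?Z \<omega> - ?U \<omega>\<bar>"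
        unfolding U by (simp only: right_diff_distrib[symmetric] abs_mult abs_exp_cancel)
      finally show "\<bar>?Z \<omega> - ?U \<omega>\<bar> \<le> ?V \<omega>" .
    qed
    \<comment> \<open>The bounds on the mean of \<open>?Z\<close> pass through these two integrable
      functions and monotonicity of the nonnegative integral, which asks for no measurability of
      \<open>?Z\<close>.\<close>
    have Ui: "integrable M ?U" and Vi: "integrable M ?V"
      using C0_finite Psi0_finite by (intro integrable_mult_right; simp)+
    have UV0: "0 \<le> ?U \<omega> + ?V \<omega>" if "\<omega> \<in> space M" for \<omega>
      using Z0[OF that] ZU[OF that] by linarith
    have "(\<integral>\<^sup>+\<omega>. ennreal (?Z \<omega>) \<partial>M) \<le> (\<integral>\<^sup>+\<omega>. ennreal (?U \<omega> + ?V \<omega>) \<partial>M)"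
    proof (intro nn_integral_mono ennreal_leI)
      fix \<omega> assume "\<omega> \<in> space M"
      from ZU[OF this] show "?Z \<omega> \<le> ?U \<omega> + ?V \<omega>" by linarith
    qed
    also have "\<dots> = ennreal (LINT \<omega>|M. ?U \<omega> + ?V \<omega>)"
      using UV0 by (intro nn_integral_eq_integral Bochner_Integration.integrable_add Ui Vi AE_I2)
    also have "(LINT \<omega>|M. ?U \<omega> + ?V \<omega>) = exp (\<nu> * t) * A + exp ((\<nu> - \<delta>) * t) * W"
      unfolding A_def W_def by (simp only: Bochner_Integration.integral_add[OF Ui Vi] integral_mult_right_zero)
    finally have up: "(\<integral>\<^sup>+\<omega>. ennreal (?Z \<omega>) \<partial>M) \<le> ennreal (exp (\<nu> * t) * A + exp ((\<nu> - \<delta>) * t) * W)" .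
    have W0: "0 \<le> W" unfolding W_def \<Psi>\<^sub>0_def by (intro integral_nonneg_AE AE_I2 mult_nonneg_nonneg) auto
    have fin: "(\<integral>\<^sup>+\<omega>. ennreal (?Z \<omega>) \<partial>M) < \<infinity>"
      using up by (rule order_le_less_trans) simp
    define q where "q = enn2real (\<integral>\<^sup>+\<omega>. ennreal (?Z \<omega>) \<partial>M)"
    have q0: "0 \<le> q" by (simp add: q_def)
    have qZ: "ennreal q = (\<integral>\<^sup>+\<omega>. ennreal (?Z \<omega>) \<partial>M)"
      using fin by (simp add: q_def less_top)
    have q_up: "q \<le> exp (\<nu> * t) * A + exp ((\<nu> - \<delta>) * t) * W"
      using up Apos W0 unfolding qZ[symmetric] by (subst (asm) ennreal_le_iff) auto
    \<comment> \<open>\<open>ennreal\<close> cuts negative values to 0: the integral of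
      \<open>?U - ?V\<close> is at most that of its positive part, and this part lies below
      \<open>?Z\<close>.\<close>
    have q_lo: "exp (\<nu> * t) * A - exp ((\<nu> - \<delta>) * t) * W \<le> q"
    proof -
      have "exp (\<nu> * t) * A - exp ((\<nu> - \<delta>) * t) * W = (LINT \<omega>|M. ?U \<omega> - ?V \<omega>)"
        unfolding A_def W_def by (simp only: Bochner_Integration.integral_diff[OF Ui Vi] integral_mult_right_zero)
      also have "\<dots> \<le> enn2real (\<integral>\<^sup>+\<omega>. ennreal (?U \<omega> - ?V \<omega>) \<partial>M)"
        by (subst real_lebesgue_integral_def[OF Bochner_Integration.integrable_diff[OF Ui Vi]]) simp
      also have "\<dots> \<le> q"
        unfolding q_def
      proof (intro enn2real_mono nn_integral_mono ennreal_leI)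
        fix \<omega> assume "\<omega> \<in> space M"
        from ZU[OF this] show "?U \<omega> - ?V \<omega> \<le> ?Z \<omega>" by linarith
      qed (use fin in simp)
      finally show ?thesis .
    qed
    have "ennreal (\<kappa>\<^sub>1 - 1) * (\<Sum>n. ennreal (\<kappa>\<^sub>1 ^ n * birth_prob t (n + 2))) = ennreal q"
      unfolding qZ using k2
      by (subst suminf_birth_prob[OF cond_law, where \<nu>=\<nu>])
         (auto intro!: nn_integral_cong simp: fx(1)[OF X0] ennreal_mult fx(2)[OF X0])
    then have sum: "(\<Sum>n. ennreal (\<kappa>\<^sub>1 ^ n * birth_prob t (n + 2))) = ennreal (q / (\<kappa>\<^sub>1 - 1))"
    proof -
      let ?S = "\<Sum>n. ennreal (\<kappa>\<^sub>1 ^ n * birth_prob t (n + 2))"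
      have "?S = ennreal (1 / (\<kappa>\<^sub>1 - 1)) * ennreal (\<kappa>\<^sub>1 - 1) * ?S"
        using k2 by (subst ennreal_mult[symmetric]) auto
      also have "\<dots> = ennreal (1 / (\<kappa>\<^sub>1 - 1)) * ennreal q"
        unfolding mult.assoc \<open>ennreal (\<kappa>\<^sub>1 - 1) * ?S = ennreal q\<close> ..
      also have "\<dots> = ennreal (q / (\<kappa>\<^sub>1 - 1))"
        using k2 q0 by (subst ennreal_mult[symmetric]) auto
      finally show ?thesis .
    qed
    have "(\<lambda>n. ennreal (\<kappa>\<^sub>1 ^ n * birth_prob t (n + 2))) sums ennreal (q / (\<kappa>\<^sub>1 - 1))"
      unfolding sum[symmetric] by (intro summable_sums) simp
    \<comment> \<open>A finite value in [0,\<infinity>] now yields the real convergence that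
      \<open>expectation_N\<close> requires.\<close>
    then have sums: "(\<lambda>n. \<kappa>\<^sub>1 ^ n * birth_prob t (n + 2)) sums (q / (\<kappa>\<^sub>1 - 1))"
      using k2 q0 by (subst (asm) sums_ennreal) (auto simp: birth_prob_def)
    have "(\<integral>\<^sup>+\<omega>. N t \<omega> \<partial>M) = ennreal (1 + (\<kappa>\<^sub>1 - 1) * birth_prob t 1 + \<kappa>\<^sub>1 * (\<kappa>\<^sub>1 - 1) * (q / (\<kappa>\<^sub>1 - 1)))"
      using k2 by (intro expectation_N[OF _ _ t sums] nn_integral_generation[OF kappa_indep kappa_ident kappa_integrable kappa_xi_indep, folded kappa1]) auto
    also have "\<kappa>\<^sub>1 * (\<kappa>\<^sub>1 - 1) * (q / (\<kappa>\<^sub>1 - 1)) = \<kappa>\<^sub>1 * q" using k2 by simp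
    finally show ?thesis using q0 q_up q_lo by (intro exI[of _ q]) (auto simp: abs_le_iff)
  qed
  define D where "D = \<kappa>\<^sub>1 * A"
  have D: "0 < D" using k2 Apos by (simp add: D_def)
  \<comment> \<open>The claimed equation solved for the error term, so that only its decay remains
    to be shown.\<close>
  define r where "r t = enn2real (\<integral>\<^sup>+\<omega>. N t \<omega> \<partial>M) / (exp (\<nu> * t) * D) - 1" for t
  have r_bound: "\<bar>r t\<bar> \<le> (\<kappa>\<^sub>1 + \<kappa>\<^sub>1 * W) / D * exp (- \<delta> * t)" if t: "0 \<le> t" for t
  proof -
    obtain q where q: "(\<integral>\<^sup>+\<omega>. N t \<omega> \<partial>M) = ennreal (1 + (\<kappa>\<^sub>1 - 1) * birth_prob t 1 + \<kappa>\<^sub>1 * q)" "0 \<le> q"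
      "\<bar>q - exp (\<nu> * t) * A\<bar> \<le> exp ((\<nu> - \<delta>) * t) * W"
      using main[OF t] by blast
    define b where "b = 1 + (\<kappa>\<^sub>1 - 1) * birth_prob t 1"
    have b: "0 \<le> b" "b \<le> \<kappa>\<^sub>1"
    proof -
      have "0 \<le> birth_prob t 1" "birth_prob t 1 \<le> 1" by (auto simp: birth_prob_def)
      then have "0 \<le> (\<kappa>\<^sub>1 - 1) * birth_prob t 1" "(\<kappa>\<^sub>1 - 1) * birth_prob t 1 \<le> (\<kappa>\<^sub>1 - 1) * 1"
        using k2 by (intro mult_nonneg_nonneg mult_left_mono; simp)+
      then show "0 \<le> b" "b \<le> \<kappa>\<^sub>1" by (simp_all add: b_def)
    qed
    have "r t * (exp (\<nu> * t) * D) = b + \<kappa>\<^sub>1 * (q - exp (\<nu> * t) * A)"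
    proof -
      have "enn2real (ennreal (b + \<kappa>\<^sub>1 * q)) = b + \<kappa>\<^sub>1 * q"
        using b q(2) k2 by (intro enn2real_ennreal) auto
      then show ?thesis
        unfolding r_def q(1) b_def[symmetric] using D by (simp add: left_diff_distrib) (simp add: D_def algebra_simps)
    qed
    then have "\<bar>r t * (exp (\<nu> * t) * D)\<bar> \<le> \<bar>b\<bar> + \<bar>\<kappa>\<^sub>1 * (q - exp (\<nu> * t) * A)\<bar>"
      by (simp only: abs_triangle_ineq)
    also have "\<bar>\<kappa>\<^sub>1 * (q - exp (\<nu> * t) * A)\<bar> \<le> \<kappa>\<^sub>1 * (exp ((\<nu> - \<delta>) * t) * W)"
      using k2 q(3) by (subst abs_mult) (auto intro!: mult_left_mono)
    \<comment> \<open>The bounded term is absorbed into the error because delta < nu makes exp((nu -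
      delta) t) at least 1.\<close>
    also have "\<bar>b\<bar> \<le> \<kappa>\<^sub>1 * exp ((\<nu> - \<delta>) * t)"
    proof -
      have "1 \<le> exp ((\<nu> - \<delta>) * t)" using delta t by simp
      then have "\<kappa>\<^sub>1 * 1 \<le> \<kappa>\<^sub>1 * exp ((\<nu> - \<delta>) * t)" using k2 by (intro mult_left_mono) auto
      then show ?thesis using b by simp
    qed
    finally have "\<bar>r t\<bar> * (exp (\<nu> * t) * D) \<le> (\<kappa>\<^sub>1 + \<kappa>\<^sub>1 * W) * exp ((\<nu> - \<delta>) * t)"
      using D by (simp add: abs_mult algebra_simps)
    also have "exp ((\<nu> - \<delta>) * t) = exp (- \<delta> * t) * exp (\<nu> * t)"
      by (simp add: algebra_simps flip: exp_add)
    finally have "\<bar>r t\<bar> * D * exp (\<nu> * t) \<le> (\<kappa>\<^sub>1 + \<kappa>\<^sub>1 * W) * exp (- \<delta> * t) * exp (\<nu> * t)"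
      by (simp only: mult_ac)
    then have "\<bar>r t\<bar> * D \<le> (\<kappa>\<^sub>1 + \<kappa>\<^sub>1 * W) * exp (- \<delta> * t)" by simp
    then show ?thesis using D by (simp add: pos_le_divide_eq)
  qed
  have "r \<in> O[at_top](\<lambda>t. exp (- \<delta> * t))"
    using r_bound by (intro bigoI[of _ "(\<kappa>\<^sub>1 + \<kappa>\<^sub>1 * W) / D"] eventually_at_top_linorderI[of 0]) auto
  moreover have "enn2real (\<integral>\<^sup>+\<omega>. N t \<omega> \<partial>M) = exp (\<nu> * t) * \<kappa>\<^sub>1 * A * (1 + r t)" for t
    unfolding r_def D_def using k2 Apos by simp
  moreover have "(\<integral>\<^sup>+\<omega>. N t \<omega> \<partial>M) < \<infinity>" if "0 \<le> t" for t
    using main[OF that] by auto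
  ultimately show ?thesis
    using delta(1) unfolding A_def by blast
qed

end
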